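(* Let $u_1,\ldots,u_m\in(\mathbb{Z}^n)^*$ be linearly independent primitive lattice vectors and $c_1,\ldots,c_m\in\mathbb{Z}$. Let $U$ be the real span of $u_1,\ldots,u_m$, and assume the regularity condition $U\cap(\mathbb{Z}^n)^*=\operatorname{span}_{\mathbb{Z}}\{u_1,\ldots,u_m\}$. Let $W=\{x\in\mathbb{R}^n:\langle u_i,x\rangle\le c_i,\ i=1,\ldots,m\}$, and for $h=(h_1,\ldots,h_m)\in\mathbb{R}^m$ let $W_h=\{x\in\mathbb{R}^n:\langle u_i,x\rangle\le c_i+h_i,\ i=1,\ldots,m\}$. Then for every $f\in C^\infty_0(\mathbb{R}^n)$, $$\frac{1}{N^n}\sum_{k\in\mathbb{Z}^n\cap NW} f\!\left(\frac{k}{N}\right)\ \sim\ \left(\tau\!\left(\frac1N\frac{\partial}{\partial h}\right)\int_{W_h} f(x)\,dx\right)(h=0)\qquad (N\to\infty,\ N\in\mathbb{Z}_+),$$ where $\tau(s_1,\ldots,s_m)=\prod_{i=1}^m\tau(s_i)$.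
   Context: $\tau(s)=\frac{s}{1-e^{-s}}$ is the Todd function, analytic near $s=0$. $C^\infty_0(\mathbb{R}^n)$ is the space of smooth compactly supported functions. $NW=\{Nx:x\in W\}$. Meaning of the asymptotic relation: write the Taylor series $\tau(s_1,\ldots,s_m)=\sum_{\alpha\in\mathbb{Z}_{\ge0}^m}t_\alpha s^\alpha$ and $F(h)=\int_{W_h}f(x)\,dx$ (smooth in $h$ near $0$). The right-hand side denotes the formal series $\sum_\alpha t_\alpha N^{-|\alpha|}(\partial_h^\alpha F)(0)$, and $A_N\sim$ this series means that for every $M\ge 1$, $A_N-\sum_{|\alpha|<M}t_\alpha N^{-|\alpha|}(\partial_h^\alpha F)(0)=O(N^{-M})$ as $N\to\infty$. *)

theory Defs
  imports "HOL-Analysis.Analysis" "HOL-Library.Landau_Symbols"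
begin

text \<open>Both the lattice \<open>\<int>\<^sup>n\<close> and its dual are the points of \<open>real ^ 'n\<close> with integer coordinates;
  the pairing of covectors and vectors is the standard inner product.\<close>

definition int_lattice :: "(real ^ 'n) set" where
  "int_lattice = {x. \<forall>j. x $ j \<in> \<int>}"

definition primitive :: "real ^ 'n \<Rightarrow> bool" where
  "primitive u \<longleftrightarrow> u \<in> int_lattice \<and> u \<noteq> 0 \<and>
     (\<forall>v\<in>int_lattice. \<forall>k::int. u = of_int k *\<^sub>R v \<longrightarrow> \<bar>k\<bar> = 1)"

text \<open>Families indexed by \<open>1, \<dots>, m\<close> in the mathematics are functions on \<open>nat\<close>, of which
  only the values at \<open>i < m\<close> matter. The case \<open>m = 0\<close> is allowed.\<close>

definition int_span :: "nat \<Rightarrow> (nat \<Rightarrow> real ^ 'n) \<Rightarrow> (real ^ 'n) set" where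
  "int_span m u = range (\<lambda>a::nat \<Rightarrow> int. \<Sum>i<m. of_int (a i) *\<^sub>R u i)"

definition halfspaces_Int :: "nat \<Rightarrow> (nat \<Rightarrow> real ^ 'n) \<Rightarrow> (nat \<Rightarrow> real) \<Rightarrow> (real ^ 'n) set" where
  "halfspaces_Int m u b = {x. \<forall>i<m. u i \<bullet> x \<le> b i}"

primrec Ck :: "nat \<Rightarrow> ('a::euclidean_space \<Rightarrow> 'b::real_normed_vector) \<Rightarrow> bool" where
  "Ck 0 f \<longleftrightarrow> continuous_on UNIV f"
| "Ck (Suc k) f \<longleftrightarrow> (\<forall>x. f differentiable (at x)) \<and>
     (\<forall>v. Ck k (\<lambda>x. frechet_derivative f (at x) v))"

definition C0_infinity :: "('a::euclidean_space \<Rightarrow> 'b::real_normed_vector) set" where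
  "C0_infinity = {f. (\<forall>k. Ck k f) \<and> compact (closure {x. f x \<noteq> 0})}"

definition partial_deriv ::
    "nat \<Rightarrow> ((nat \<Rightarrow> real) \<Rightarrow> 'b::real_normed_vector) \<Rightarrow> (nat \<Rightarrow> real) \<Rightarrow> 'b" where
  "partial_deriv i F h = vector_derivative (\<lambda>t. F (h(i := t))) (at (h i))"

definition multi_indices :: "nat \<Rightarrow> (nat \<Rightarrow> nat) set" where
  "multi_indices m = {\<alpha>. \<forall>i\<ge>m. \<alpha> i = 0}"

definition multi_degree :: "nat \<Rightarrow> (nat \<Rightarrow> nat) \<Rightarrow> nat" where
  "multi_degree m \<alpha> = (\<Sum>i<m. \<alpha> i)"

text \<open>The derivatives are nested as \<open>\<partial>\<^sub>0\<^bsup>\<alpha> 0\<^esup> (\<partial>\<^sub>1\<^bsup>\<alpha> 1\<^esup> (\<dots> F))\<close>; the order is immaterial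
  where \<open>F\<close> is smooth.\<close>

definition mixed_partial ::
    "nat \<Rightarrow> (nat \<Rightarrow> nat) \<Rightarrow> ((nat \<Rightarrow> real) \<Rightarrow> 'b::real_normed_vector) \<Rightarrow> (nat \<Rightarrow> real) \<Rightarrow> 'b" where
  "mixed_partial m \<alpha> F = foldr (\<lambda>i. partial_deriv i ^^ \<alpha> i) [0..<m] F"

definition taylor_coeff :: "nat \<Rightarrow> ((nat \<Rightarrow> real) \<Rightarrow> real) \<Rightarrow> (nat \<Rightarrow> nat) \<Rightarrow> real" where
  "taylor_coeff m G \<alpha> = mixed_partial m \<alpha> G (\<lambda>_. 0) / (\<Prod>i<m. fact (\<alpha> i))"

text \<open>The singularity of \<open>s / (1 - e\<^sup>-\<^sup>s)\<close> at \<open>0\<close> is removable, with limit \<open>1\<close>.\<close>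

definition todd :: "real \<Rightarrow> real" where
  "todd s = (if s = 0 then 1 else s / (1 - exp (- s)))"

definition todd_multi :: "nat \<Rightarrow> (nat \<Rightarrow> real) \<Rightarrow> real" where
  "todd_multi m s = (\<Prod>i<m. todd (s i))"

text \<open>The truncation to orders \<open>< M\<close> of the formal series \<open>(G (\<epsilon> \<partial>/\<partial>h) F) (h = 0)\<close>.\<close>

definition diff_op_trunc ::
    "nat \<Rightarrow> ((nat \<Rightarrow> real) \<Rightarrow> real) \<Rightarrow> real \<Rightarrow> ((nat \<Rightarrow> real) \<Rightarrow> 'b::real_normed_vector) \<Rightarrow> nat \<Rightarrow> 'b" where
  "diff_op_trunc m G \<epsilon> F M =
     (\<Sum>\<alpha> | \<alpha> \<in> multi_indices m \<and> multi_degree m \<alpha> < M.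
        (taylor_coeff m G \<alpha> * \<epsilon> ^ multi_degree m \<alpha>) *\<^sub>R mixed_partial m \<alpha> F (\<lambda>_. 0))"

end

theory Submission
  imports Defs "HOL-Complex_Analysis.Complex_Analysis"
begin

text \<open>
  Write \<open>\<sigma>\<^sub>f z = N\<^sup>-\<^sup>n (\<Sum>k\<in>\<int>\<^sup>n \<inter> NW. f ((k + z) / N))\<close>; the sum in question is \<open>\<sigma>\<^sub>f 0\<close>.
  Regularity gives lattice vectors \<open>v\<^sub>j\<close> dual to the \<open>u\<^sub>i\<close>, hence a projection \<open>P\<close> of
  \<open>\<int>\<^sup>n\<close> onto \<open>\<int>\<^sup>n \<inter> U\<^sup>\<bottom>\<close>, and no completion to a lattice basis is needed. Cutting \<open>W\<close> into
  translates of the unit cube \<open>C\<close> shows that \<open>\<integral>\<^sub>W f\<close> is the average over \<open>y \<in> C\<close> of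
  \<open>\<sigma>\<^sub>f (P y - (\<Sum>i<m. \<rho>\<^sub>i y v\<^sub>i))\<close> with \<open>\<rho>\<^sub>i y = \<lceil>\<langle>u\<^sub>i, y\<rangle>\<rceil> - \<langle>u\<^sub>i, y\<rangle>\<close>. By translation invariance
  each \<open>\<rho>\<^sub>i\<close> may be replaced by an independent uniform variable on \<open>[0, 1]\<close>, so the terms
  \<open>\<rho>\<^sub>i y v\<^sub>i\<close> can be removed one at a time with the one-variable expansion
  \<open>q 0 \<sim> (\<Sum>a. (- 1)\<^sup>a t\<^sub>a \<integral>\<^sub>0\<^sup>1 q\<^sup>(\<^sup>a\<^sup>))\<close>, where \<open>t\<^sub>a\<close> are the Todd coefficients; each derivative of
  \<open>\<sigma>\<^sub>f\<close> gains a factor \<open>1 / N\<close>. Along \<open>U\<^sup>\<bottom>\<close> the function \<open>\<sigma>\<^sub>f\<close> is periodic, so the same expansion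
  makes it constant up to \<open>O(N\<^sup>-\<^sup>M)\<close>.
\<close>

no_notation fps_nth (infixl "$" 75)

section \<open>The Todd function\<close>

text \<open>The complex extension of \<open>todd\<close>: holomorphy gives derivatives of all orders
  across the removable singularity, and a power series at 0.\<close>

definition ctodd :: "complex \<Rightarrow> complex" where
  "ctodd z = (if z = 0 then 1 else z / (1 - exp (- z)))"

text \<open>The zeros of \<open>1 - exp (- z)\<close> are the integer multiples of
  \<open>2 * pi * \<i>\<close>. Only 0 lies in this strip, which still contains the whole real
  line.\<close>

definition strip :: "complex set" where
  "strip = {z. \<bar>Im z\<bar> < 2 * pi}"

lemma open_strip: "open strip"
  unfolding strip_def by (intro open_Collect_less continuous_intros)

lemma exp_eq_1_strip: "z \<in> strip \<Longrightarrow> exp (- z) = 1 \<Longrightarrow> z = 0"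
proof -
  assume z: "z \<in> strip" and "exp (- z) = 1"
  then obtain n :: int where n: "Re z = 0" "Im (-z) = of_int (2 * n) * pi"
    by (auto simp: exp_eq_1)
  have "\<bar>of_int n :: real\<bar> * (2 * pi) < 2 * pi"
  proof -
    have "Im z = - (of_int n * (2 * pi))" using n(2) by simp
    then have "\<bar>Im z\<bar> = \<bar>of_int n\<bar> * (2 * pi)" by (simp add: abs_mult)
    then show ?thesis using z by (simp add: strip_def)
  qed
  then have "\<bar>of_int n :: real\<bar> < 1" by simp
  then have "n = 0" by linarith
  with n show "z = 0" by (simp add: complex_eq_iff)
qed

text \<open>The reciprocal \<open>(1 - exp (- z)) / z\<close> is a difference quotient at 0 of a
  function with derivative 1 there.\<close>

lemma tendsto_ctodd: "(ctodd \<longlongrightarrow> 1) (at 0)"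
proof -
  have "((\<lambda>z::complex. 1 - exp (- z)) has_field_derivative 1) (at 0)"
    by (auto intro!: derivative_eq_intros)
  then have "((\<lambda>z::complex. (1 - exp (- z)) / z) \<longlongrightarrow> 1) (at 0)"
    by (simp add: has_field_derivative_iff)
  from tendsto_inverse[OF this] have "((\<lambda>z::complex. inverse ((1 - exp (- z)) / z)) \<longlongrightarrow> 1) (at 0)"
    by simp
  then show ?thesis
    by (rule Lim_transform_eventually) (auto simp: ctodd_def eventually_at_filter)
qed

lemma holomorphic_ctodd: "ctodd holomorphic_on strip"
proof (rule no_isolated_singularity')
  show "ctodd holomorphic_on strip - {0}"
  proof (rule holomorphic_transform)
    show "(\<lambda>z. z / (1 - exp (- z))) holomorphic_on strip - {0}"
      by (intro holomorphic_intros) (use exp_eq_1_strip in auto)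
  qed (auto simp: ctodd_def)
  show "(ctodd \<longlongrightarrow> ctodd z) (at z within strip)" if "z \<in> {0}" for z
    using that tendsto_ctodd by (auto simp: ctodd_def intro: tendsto_within_subset)
qed (auto simp: open_strip)

text \<open>The derivatives of \<open>todd\<close> on the real line. Taking them from the complex
  function avoids differentiating the real quotient at 0.\<close>

definition dtodd :: "nat \<Rightarrow> real \<Rightarrow> real" where
  "dtodd a x = Re ((deriv ^^ a) ctodd (of_real x))"

lemma dtodd_0: "dtodd 0 = todd"
proof
  fix x :: real
  have "exp (- complex_of_real x) = of_real (exp (- x))"
    by (metis exp_of_real of_real_minus)
  then have "ctodd (of_real x) = of_real (todd x)"
    by (simp add: ctodd_def todd_def)
  then show "dtodd 0 x = todd x"
    by (simp add: dtodd_def)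
qed

lemma of_real_strip: "of_real x \<in> strip"
  by (simp add: strip_def)

lemma dtodd_deriv: "(dtodd a has_real_derivative dtodd (Suc a) x) (at x)"
proof -
  have "((deriv ^^ a) ctodd has_field_derivative (deriv ^^ Suc a) ctodd (of_real x)) (at (of_real x))"
    using holomorphic_derivI[OF holomorphic_higher_deriv[OF holomorphic_ctodd open_strip, of a] open_strip of_real_strip]
    by simp
  from has_vector_derivative_real_field[OF this]
  have "((\<lambda>x. Re ((deriv ^^ a) ctodd (of_real x))) has_vector_derivative dtodd (Suc a) x) (at x)"
    unfolding dtodd_def by (rule bounded_linear.has_vector_derivative[OF bounded_linear_Re])
  then show ?thesis
    by (simp add: dtodd_def[abs_def] has_real_derivative_iff_has_vector_derivative)
qed

definition todd_coeff :: "nat \<Rightarrow> real" where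
  "todd_coeff a = dtodd a 0 / fact a"

text \<open>The identity \<open>ctodd z * (1 - exp (- z)) = z\<close> holds on all of
  \<open>strip\<close>, 0 included, so it passes to power series.\<close>

lemma todd_coeff_fps:
  "fps_expansion ctodd 0 * (1 - fps_exp (- 1)) = fps_X"
proof -
  have "ctodd analytic_on {0}"
    using holomorphic_ctodd open_strip of_real_strip[of 0] analytic_at by fastforce
  then have 1: "ctodd has_fps_expansion fps_expansion ctodd 0"
    by (rule analytic_at_imp_has_fps_expansion_0)
  have 2: "(\<lambda>z::complex. 1 - exp (-z)) has_fps_expansion (1 - fps_exp (- 1))"
    using has_fps_expansion_exp[of "- 1 :: complex"]
    by (intro has_fps_expansion_diff) (auto)
  have "(\<lambda>z. ctodd z * (1 - exp (- z))) has_fps_expansion (fps_expansion ctodd 0 * (1 - fps_exp (- 1)))"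
    by (intro has_fps_expansion_mult 1 2)
  also have "?this \<longleftrightarrow> (\<lambda>z. z) has_fps_expansion (fps_expansion ctodd 0 * (1 - fps_exp (- 1)))"
  proof (rule has_fps_expansion_cong)
    have "eventually (\<lambda>z. z \<in> strip) (nhds 0)"
      using open_strip of_real_strip[of 0] by (auto simp: eventually_nhds)
    then show "eventually (\<lambda>z. ctodd z * (1 - exp (- z)) = z) (nhds 0)"
      by eventually_elim (use exp_eq_1_strip in \<open>auto simp: ctodd_def\<close>)
  qed auto
  finally show ?thesis
    using has_fps_expansion_fps_X fps_expansion_unique_complex by blast
qed

text \<open>Compare coefficients of index \<open>Suc c\<close> in \<open>todd_coeff_fps\<close>,
  where the constant term of the second factor vanishes, and multiply by \<open>(- 1) ^ c\<close>.
  Since \<open>1 / fact (b + 1)\<close> is the integral of \<open>x ^ b / fact b\<close> over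
  \<open>[0, 1]\<close>, this says that the signed Todd series inverts averaging over
  \<open>[0, 1]\<close>.\<close>

lemma todd_coeff_recurrence:
  "(\<Sum>a\<le>c. (- 1) ^ a * todd_coeff a / fact (c - a + 1)) = (if c = 0 then 1 else 0)"
proof -
  let ?F = "fps_expansion ctodd 0"
  have F: "Re (fps_nth ?F a) = todd_coeff a" for a
  proof -
    have "fps_nth ?F a = (deriv ^^ a) ctodd 0 / of_real (fact a)"
      by (simp add: fps_expansion_def)
    then show ?thesis
      by (simp only: Re_divide_of_real todd_coeff_def dtodd_def of_real_0)
  qed
  have G: "fps_nth (1 - fps_exp (- 1 :: complex)) (Suc c - a) = of_real ((- 1) ^ (c - a) / fact (c - a + 1))" if "a \<le> c" for a
    using that by (simp add: Suc_diff_le ring_distribs)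
  have "fps_nth (?F * (1 - fps_exp (- 1))) (Suc c) = (if c = 0 then 1 else 0)"
    by (simp add: todd_coeff_fps)
  also have "fps_nth (?F * (1 - fps_exp (- 1))) (Suc c) =
     (\<Sum>a\<le>c. fps_nth ?F a * of_real ((- 1) ^ (c - a) / fact (c - a + 1)))"
  proof -
    have "fps_nth (1 - fps_exp (- 1 :: complex)) 0 = 0" by simp
    then show ?thesis
      unfolding fps_mult_nth atMost_atLeast0[symmetric] atMost_Suc
      by (simp add: G del: fps_sub_nth)
  qed
  finally have "Re (\<Sum>a\<le>c. fps_nth ?F a * of_real ((- 1) ^ (c - a) / fact (c - a + 1))) = (if c = 0 then 1 else 0)"
    by simp
  then have *: "(\<Sum>a\<le>c. todd_coeff a * ((- 1) ^ (c - a) / fact (c - a + 1))) = (if c = 0 then 1 else 0)"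
    unfolding Re_sum by (simp only: times_complex.sel Re_complex_of_real Im_complex_of_real F mult_zero_right diff_zero)
  have "(\<Sum>a\<le>c. (- 1) ^ a * todd_coeff a / fact (c - a + 1)) =
      (- 1) ^ c * (\<Sum>a\<le>c. todd_coeff a * ((- 1) ^ (c - a) / fact (c - a + 1)))"
    unfolding sum_distrib_left
    by (rule sum.cong) (auto simp: uminus_power_if)
  then show ?thesis unfolding * by simp
qed

section \<open>Taylor coefficients of a product of functions of separate variables\<close>

lemma partial_deriv_prod:
  fixes d :: "nat \<Rightarrow> real \<Rightarrow> real"
  assumes "\<And>a x. (d a has_real_derivative d (Suc a) x) (at x)" and "i < m"
  shows "partial_deriv i (\<lambda>s. \<Prod>j<m. d (\<beta> j) (s j)) = (\<lambda>s. \<Prod>j<m. d ((\<beta>(i := Suc (\<beta> i))) j) (s j))"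
proof
  fix h :: "nat \<Rightarrow> real"
  have split: "(\<Prod>j<m. G j) = G i * (\<Prod>j\<in>{..<m}-{i}. G j)" for G :: "nat \<Rightarrow> real"
    using assms(2) by (subst prod.remove[of _ i]) auto
  have "((\<lambda>t. d (\<beta> i) t * (\<Prod>j\<in>{..<m}-{i}. d (\<beta> j) (h j))) has_real_derivative
         d (Suc (\<beta> i)) (h i) * (\<Prod>j\<in>{..<m}-{i}. d (\<beta> j) (h j))) (at (h i))"
    by (intro DERIV_cmult_right assms)
  then have "((\<lambda>t. \<Prod>j<m. d (\<beta> j) ((h(i:=t)) j)) has_vector_derivative
         (\<Prod>j<m. d ((\<beta>(i := Suc (\<beta> i))) j) (h j))) (at (h i))"
    by (simp add: split has_real_derivative_iff_has_vector_derivative)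
  then show "partial_deriv i (\<lambda>s. \<Prod>j<m. d (\<beta> j) (s j)) h = (\<Prod>j<m. d ((\<beta>(i := Suc (\<beta> i))) j) (h j))"
    unfolding partial_deriv_def by (rule vector_derivative_at)
qed

lemma partial_deriv_pow_prod:
  fixes d :: "nat \<Rightarrow> real \<Rightarrow> real"
  assumes "\<And>a x. (d a has_real_derivative d (Suc a) x) (at x)" and "i < m"
  shows "(partial_deriv i ^^ k) (\<lambda>s. \<Prod>j<m. d (\<beta> j) (s j)) = (\<lambda>s. \<Prod>j<m. d ((\<beta>(i := \<beta> i + k)) j) (s j))"
proof (induction k)
  case (Suc k)
  show ?case
    by (simp only: funpow.simps o_def Suc partial_deriv_prod[where d=d, OF assms]) (rule ext, rule prod.cong, auto)
qed simp

lemma mixed_partial_prod: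
  fixes d :: "nat \<Rightarrow> real \<Rightarrow> real"
  assumes "\<And>a x. (d a has_real_derivative d (Suc a) x) (at x)"
  shows "mixed_partial m \<alpha> (\<lambda>s. \<Prod>j<m. d 0 (s j)) = (\<lambda>s. \<Prod>j<m. d (\<alpha> j) (s j))"
proof -
  \<comment> \<open>After the variables in \<open>xs\<close> have been treated, exactly these carry
    their full order. Distinctness ensures that each order is raised from 0 only once.\<close>
  have *: "foldr (\<lambda>i. partial_deriv i ^^ \<alpha> i) xs (\<lambda>s. \<Prod>j<m. d 0 (s j)) =
     (\<lambda>s. \<Prod>j<m. d (if j \<in> set xs then \<alpha> j else 0) (s j))"
    if "distinct xs" "set xs \<subseteq> {..<m}" for xs
    using that
  proof (induction xs)
    case (Cons i xs)
    then have "foldr (\<lambda>i. partial_deriv i ^^ \<alpha> i) (i # xs) (\<lambda>s. \<Prod>j<m. d 0 (s j)) =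
        (partial_deriv i ^^ \<alpha> i) (\<lambda>s. \<Prod>j<m. d (if j \<in> set xs then \<alpha> j else 0) (s j))"
      by simp
    also have "\<dots> = (\<lambda>s. \<Prod>j<m. d (if j \<in> set (i # xs) then \<alpha> j else 0) (s j))"
      using Cons.prems
      by (subst partial_deriv_pow_prod[where d=d, OF assms]) (auto intro!: ext prod.cong)
    finally show ?case .
  qed simp
  show ?thesis
    unfolding mixed_partial_def by (subst *) (auto intro!: prod.cong)
qed

lemma taylor_coeff_todd_multi: "taylor_coeff m (todd_multi m) \<alpha> = (\<Prod>i<m. todd_coeff (\<alpha> i))"
proof -
  have "todd_multi m = (\<lambda>s. \<Prod>j<m. dtodd 0 (s j))"
    by (simp add: todd_multi_def fun_eq_iff dtodd_0)
  then show ?thesis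
    by (simp add: taylor_coeff_def mixed_partial_prod[where d=dtodd, OF dtodd_deriv] todd_coeff_def prod_dividef)
qed

section \<open>The one-variable expansion of a value in averages of derivatives\<close>

lemma DERIV_pow_over_fact:
  "((\<lambda>x. x ^ Suc b / fact (Suc b)) has_real_derivative (x ^ b / fact b)) (at x within S)"
proof -
  have "((\<lambda>x. x ^ Suc b / fact (Suc b)) has_real_derivative (real (Suc b) * x ^ b / fact (Suc b))) (at x within S)"
    using DERIV_cdivide[OF DERIV_pow[of "Suc b" x S], of "fact (Suc b)"]
    by (simp only: diff_Suc_Suc minus_nat.diff_0)
  also have "real (Suc b) * x ^ b / fact (Suc b) = x ^ b / fact b"
    by (simp del: of_nat_Suc)
  finally show ?thesis .
qed

text \<open>Induction on \<open>M\<close>: the derivative of the remainder is the remainder of the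
  shifted family \<open>\<lambda>a. q (Suc a)\<close>, of order one less. The remainder vanishes at
  0, so the mean value inequality on \<open>[0, 1]\<close>, which is valid for vector values, passes
  the bound on. The factor \<open>1 / fact M\<close> is given away.\<close>

lemma taylor_norm_bound:
  fixes q :: "nat \<Rightarrow> real \<Rightarrow> 'b::real_normed_vector"
  assumes "\<And>a x. x \<in> {0..1} \<Longrightarrow> (q a has_vector_derivative q (Suc a) x) (at x within {0..1})"
    and "\<And>x. x \<in> {0..1} \<Longrightarrow> norm (q M x) \<le> B" and "x \<in> {0..1}"
  shows "norm (q 0 x - (\<Sum>b<M. (x ^ b / fact b) *\<^sub>R q b 0)) \<le> B"
  using assms
proof (induction M arbitrary: q x)
  case (Suc M)
  define r where "r = (\<lambda>x. q 0 x - (\<Sum>b<Suc M. (x ^ b / fact b) *\<^sub>R q b 0))"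
  define r' where "r' = (\<lambda>x. q 1 x - (\<Sum>b<M. (x ^ b / fact b) *\<^sub>R q (Suc b) 0))"
  have r: "(r has_vector_derivative r' x) (at x within {0..1})" if "x \<in> {0..1}" for x
  proof -
    have p: "((\<lambda>x. (x ^ Suc b / fact (Suc b)) *\<^sub>R q (Suc b) 0) has_vector_derivative
         (x ^ b / fact b) *\<^sub>R q (Suc b) 0) (at x within {0..1})" for b
    proof -
      have "((\<lambda>x. x ^ Suc b / fact (Suc b)) has_real_derivative (x ^ b / fact b)) (at x within {0..1})"
        by (rule DERIV_pow_over_fact)
      from has_vector_derivative_scaleR[OF this has_vector_derivative_const] show ?thesis
        by simp
    qed
    have "((\<lambda>x. q 0 x - (q 0 0 + (\<Sum>b<M. (x ^ Suc b / fact (Suc b)) *\<^sub>R q (Suc b) 0))) has_vector_derivative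
        (q 1 x - (0 + (\<Sum>b<M. (x ^ b / fact b) *\<^sub>R q (Suc b) 0)))) (at x within {0..1})"
      using Suc.prems(1)[OF that, of 0]
      by (intro has_vector_derivative_diff has_vector_derivative_add has_vector_derivative_sum p has_vector_derivative_const) auto
    then show ?thesis
      unfolding r_def r'_def by (simp add: sum.lessThan_Suc_shift del: sum.lessThan_Suc power_Suc fact_Suc)
  qed
  have b: "norm (r' x) \<le> B" if "x \<in> {0..1}" for x
    unfolding r'_def using Suc.IH[of "\<lambda>a. q (Suc a)"] Suc.prems that by simp
  then have B0: "B \<ge> 0"
    by (metis norm_ge_zero order_trans Suc.prems(3))
  have "norm (r x - r 0) \<le> B * norm (x - 0)"
  proof (rule differentiable_bound[where S="{0..1}"])
    show "(r has_derivative (\<lambda>t. t *\<^sub>R r' x)) (at x within {0..1})" if "x \<in> {0..1}" for x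
      using r[OF that] by (simp add: has_vector_derivative_def)
    show "onorm (\<lambda>t. t *\<^sub>R r' x) \<le> B" if "x \<in> {0..1}" for x
    proof (rule onorm_bound[OF B0])
      show "norm (t *\<^sub>R r' x) \<le> B * norm t" for t
        using mult_right_mono[OF b[OF that], of "\<bar>t\<bar>"] by (simp add: mult.commute)
    qed
  qed (use Suc.prems in auto)
  also have "\<dots> \<le> B"
    using B0 Suc.prems(3) by (auto simp: mult_left_le)
  also have "r 0 = 0"
    by (simp add: r_def sum.lessThan_Suc_shift del: sum.lessThan_Suc)
  finally show ?case by (simp add: r_def)
qed simp

text \<open>An Euler-Maclaurin formula with remainder. Expand each average by Taylor's formula at 0;
  the coefficient of \<open>q c 0\<close> in the resulting double sum is the one in
  \<open>todd_coeff_recurrence\<close>, so only \<open>q 0 0\<close> survives.\<close>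

lemma todd_expansion_1d:
  fixes q :: "nat \<Rightarrow> real \<Rightarrow> 'b::banach"
  assumes q: "\<And>a x. x \<in> {0..1} \<Longrightarrow> (q a has_vector_derivative q (Suc a) x) (at x within {0..1})"
    and B: "\<And>x. x \<in> {0..1} \<Longrightarrow> norm (q M x) \<le> B"
  shows "norm (q 0 0 - (\<Sum>a<M. ((- 1) ^ a * todd_coeff a) *\<^sub>R integral {0..1} (q a)))
     \<le> (1 + (\<Sum>a<M. \<bar>todd_coeff a\<bar>)) * B"
proof (cases "M = 0")
  \<comment> \<open>The sum is empty and \<open>q 0\<close> itself is bounded by \<open>B\<close>;
    this case is what the summand 1 in the constant is for.\<close>
  case True
  then show ?thesis using B[of 0] by simp
next
  case False
  have B0: "B \<ge> 0" using order_trans[OF norm_ge_zero B[of 0]] by simp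
  \<comment> \<open>The averaged Taylor remainder of \<open>q a\<close>. Stopping at order
    \<open>M - a\<close> keeps all derivatives at 0 below order \<open>M\<close> and lets
    \<open>q M\<close> control every remainder.\<close>
  define e where "e a = integral {0..1} (q a) - (\<Sum>b<M-a. (1 / fact (b+1)) *\<^sub>R q (a + b) 0)" for a
  have e: "norm (e a) \<le> B" if "a < M" for a
  proof -
    have 1: "((\<lambda>x. q a x - (\<Sum>b<M-a. (x ^ b / fact b) *\<^sub>R q (a + b) 0)) has_integral e a) {0..1}"
      unfolding e_def
    proof (intro has_integral_diff has_integral_sum)
      have "continuous_on {0..1} (q a)"
        using q has_vector_derivative_continuous continuous_on_eq_continuous_within by blast
      then show "(q a has_integral integral {0..1} (q a)) {0..1}"
        by (intro integrable_integral integrable_continuous_real)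
      show "((\<lambda>x. (x ^ b / fact b) *\<^sub>R q (a + b) 0) has_integral (1 / fact (b + 1)) *\<^sub>R q (a + b) 0) {0..1}" for b
      proof (rule has_integral_scaleR_left)
        have "((\<lambda>x. x ^ b / fact b) has_integral (1 ^ Suc b / fact (Suc b) - 0 ^ Suc b / fact (Suc b))) {0..1::real}"
        proof (rule fundamental_theorem_of_calculus)
          fix x :: real
          have "((\<lambda>x. x ^ Suc b / fact (Suc b)) has_real_derivative (x ^ b / fact b)) (at x within {0..1})"
            by (rule DERIV_pow_over_fact)
          then show "((\<lambda>x. x ^ Suc b / fact (Suc b)) has_vector_derivative (x ^ b / fact b)) (at x within {0..1})"
            by (simp only: has_real_derivative_iff_has_vector_derivative)
        qed simp
        then show "((\<lambda>x. x ^ b / fact b) has_integral (1 / fact (b + 1))) {0..1::real}" by simp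
      qed
    qed simp
    have "norm (q a x - (\<Sum>b<M-a. (x ^ b / fact b) *\<^sub>R q (a + b) 0)) \<le> B" if "x \<in> {0..1}" for x
      using taylor_norm_bound[of "\<lambda>b. q (a + b)" "M - a" B x] q B that \<open>a < M\<close> by simp
    then show ?thesis
      using has_integral_bound_real[OF B0 _ 1, of "{}"] by simp
  qed
  \<comment> \<open>Regroup by the total order \<open>c = a + b\<close>.\<close>
  have "(\<Sum>a<M. \<Sum>b<M-a. ((- 1) ^ a * todd_coeff a / fact (b + 1)) *\<^sub>R q (a + b) 0)
      = (\<Sum>c<M. \<Sum>a\<le>c. ((- 1) ^ a * todd_coeff a / fact (c - a + 1)) *\<^sub>R q c 0)"
    unfolding sum.Sigma[OF finite_lessThan ballI[OF finite_lessThan]] sum.Sigma[OF finite_lessThan ballI[OF finite_atMost]]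
    by (rule sum.reindex_bij_witness[of _ "\<lambda>(c,a). (a, c - a)" "\<lambda>(a,b). (a + b, a)"]) auto
  also have "\<dots> = (\<Sum>c<M. (if c = 0 then 1 else 0) *\<^sub>R q c 0)"
    by (simp only: scaleR_sum_left[symmetric] todd_coeff_recurrence)
  also have "\<dots> = q 0 0"
    using False by (subst sum.remove[of _ 0]) (auto intro!: sum.neutral)
  finally have main: "(\<Sum>a<M. \<Sum>b<M-a. ((- 1) ^ a * todd_coeff a / fact (b + 1)) *\<^sub>R q (a + b) 0) = q 0 0" .
  have "norm (q 0 0 - (\<Sum>a<M. ((- 1) ^ a * todd_coeff a) *\<^sub>R integral {0..1} (q a))) =
     norm (\<Sum>a<M. ((- 1) ^ a * todd_coeff a) *\<^sub>R e a)"
    unfolding main[symmetric] e_def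
    by (simp add: scaleR_diff_right sum_subtractf scaleR_sum_right norm_minus_commute)
  also have "\<dots> \<le> (\<Sum>a<M. \<bar>todd_coeff a\<bar> * B)"
    by (rule sum_norm_le) (auto simp: abs_mult e mult_left_mono)
  also have "\<dots> \<le> (1 + (\<Sum>a<M. \<bar>todd_coeff a\<bar>)) * B"
    using B0 by (simp add: sum_distrib_right ring_distribs)
  finally show ?thesis .
qed

section \<open>Dual lattice vectors\<close>

lemma int_lattice_0: "0 \<in> int_lattice"
  by (simp add: int_lattice_def)

lemma int_lattice_add: "x \<in> int_lattice \<Longrightarrow> y \<in> int_lattice \<Longrightarrow> x + y \<in> int_lattice"
  by (simp add: int_lattice_def)

lemma int_lattice_diff: "x \<in> int_lattice \<Longrightarrow> y \<in> int_lattice \<Longrightarrow> x - y \<in> int_lattice"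
  by (simp add: int_lattice_def)

lemma int_lattice_scaleR: "a \<in> \<int> \<Longrightarrow> x \<in> int_lattice \<Longrightarrow> a *\<^sub>R x \<in> int_lattice"
  by (simp add: int_lattice_def)

lemma int_lattice_sum: "(\<And>i. i \<in> I \<Longrightarrow> x i \<in> int_lattice) \<Longrightarrow> sum x I \<in> int_lattice"
  by (induction I rule: infinite_finite_induct) (auto intro: int_lattice_0 int_lattice_add)

lemma int_lattice_axis: "axis j 1 \<in> int_lattice"
  by (simp add: int_lattice_def axis_def)

lemma int_lattice_inner: "x \<in> int_lattice \<Longrightarrow> y \<in> int_lattice \<Longrightarrow> x \<bullet> y \<in> \<int>"
  unfolding int_lattice_def inner_vec_def by (auto intro!: Ints_sum)

text \<open>The values of \<open>u'\<close> on the lattice form a subgroup of the integers. Its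
  least positive element \<open>d\<close> divides every value, in particular every coordinate of
  \<open>u'\<close>, so \<open>u'\<close> is divisible by \<open>d\<close> in the lattice and
  \<open>prim\<close> gives \<open>d = 1\<close>.\<close>

lemma primitive_value:
  fixes u' :: "real ^ 'n"
  assumes u': "u' \<in> int_lattice" "u' \<noteq> 0"
    and prim: "\<And>d::nat. d > 0 \<Longrightarrow> (1 / real d) *\<^sub>R u' \<in> int_lattice \<Longrightarrow> d = 1"
  shows "\<exists>x\<in>int_lattice. u' \<bullet> x = 1"
proof -
  define Q where "Q = (\<lambda>d::nat. d > 0 \<and> (\<exists>x\<in>int_lattice. u' \<bullet> x = real d))"
  have "u' \<bullet> u' \<in> \<int>" using u' by (simp add: int_lattice_inner)
  then obtain k :: int where k: "u' \<bullet> u' = of_int k" by (auto elim: Ints_cases)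
  moreover have "u' \<bullet> u' > 0" using u' by simp
  ultimately have "k > 0" by simp
  \<comment> \<open>Pairing \<open>u'\<close> with itself shows that some positive value is
    attained.\<close>
  with k u' have "Q (nat k)" unfolding Q_def by (auto intro!: bexI[of _ u'])
  define d where "d = (LEAST d. Q d)"
  have "Q d" unfolding d_def by (rule LeastI) fact
  then obtain x0 where d: "d > 0" and x0: "x0 \<in> int_lattice" "u' \<bullet> x0 = real d"
    by (auto simp: Q_def)
  have dvd: "\<exists>q::int. u' \<bullet> x = of_int q * real d" if x: "x \<in> int_lattice" for x
  proof -
    obtain n :: int where n: "u' \<bullet> x = of_int n"
      using int_lattice_inner[OF u'(1) x] by (auto elim: Ints_cases)
    \<comment> \<open>Division with remainder: \<open>u' \<bullet> y\<close> is the residue of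
      \<open>n\<close> modulo \<open>d\<close>, which by minimality of \<open>d\<close> cannot be
      positive.\<close>
    define y where "y = x - of_int (n div int d) *\<^sub>R x0"
    have y: "y \<in> int_lattice" unfolding y_def
      using x x0 by (intro int_lattice_diff int_lattice_scaleR) auto
    have "u' \<bullet> y = of_int n - of_int (n div int d) * real d"
      by (simp add: y_def inner_diff_right n x0)
    also have "\<dots> = of_int (n mod int d)"
      by (metis minus_div_mult_eq_mod of_int_diff of_int_mult of_int_of_nat_eq)
    finally have uy: "u' \<bullet> y = of_int (n mod int d)" .
    have "n mod int d = 0"
    proof (rule ccontr)
      assume "n mod int d \<noteq> 0"
      then have pos: "n mod int d > 0" using d pos_mod_sign[of "int d" n] by linarith
      then have "Q (nat (n mod int d))"
        unfolding Q_def using y uy by (auto intro!: bexI[of _ y])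
      then have "d \<le> nat (n mod int d)" unfolding d_def by (rule Least_le)
      moreover have "n mod int d < int d" using d by simp
      ultimately show False using pos by linarith
    qed
    then have "n = (n div int d) * int d" by (metis add.right_neutral div_mult_mod_eq)
    then have "real_of_int n = of_int (n div int d) * real d"
      by (metis of_int_mult of_int_of_nat_eq)
    then show ?thesis using n by metis
  qed
  have "(1 / real d) *\<^sub>R u' \<in> int_lattice"
    unfolding int_lattice_def
  proof (clarsimp)
    fix j
    obtain q :: int where "u' \<bullet> axis j 1 = of_int q * real d"
      using dvd[OF int_lattice_axis] by blast
    then have "u' $ j / real d = of_int q" using d by (simp add: inner_axis)
    then show "u' $ j / real d \<in> \<int>" by simp
  qed
  with prim[OF d] x0 show ?thesis by auto
qed

lemma coeffs_eq_0:
  fixes u :: "nat \<Rightarrow> 'a::real_vector"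
  assumes inj: "inj_on u {..<m}" and ind: "independent (u ` {..<m})"
    and "(\<Sum>i<m. a i *\<^sub>R u i) = 0" and "i < m"
  shows "a i = 0"
proof -
  have "(\<Sum>w\<in>u ` {..<m}. a (inv_into {..<m} u w) *\<^sub>R w) = (\<Sum>i<m. a i *\<^sub>R u i)"
    by (subst sum.reindex[OF inj]) (auto simp: inj intro!: sum.cong)
  then have "a (inv_into {..<m} u (u i)) = 0"
    using assms by (intro independentD[OF ind, of "u ` {..<m}"]) auto
  then show ?thesis using assms by (simp add: inj)
qed

text \<open>A biorthogonal system is built one vector at a time. Correct \<open>u k\<close> to a
  lattice covector \<open>u'\<close> that kills the earlier \<open>v i\<close>. Regularity makes
  \<open>u'\<close> indivisible, so it takes the value 1 at some lattice vector, from which the new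
  dual vector is obtained.\<close>

lemma dual_lattice_vectors:
  fixes u :: "nat \<Rightarrow> real ^ 'n"
  assumes lin_indep: "inj_on u {..<m}" "independent (u ` {..<m})"
    and regular: "span (u ` {..<m}) \<inter> int_lattice = int_span m u"
  shows "\<exists>v. (\<forall>j<m. v j \<in> int_lattice) \<and> (\<forall>i<m. \<forall>j<m. u i \<bullet> v j = (if i = j then 1 else 0))"
proof -
  have u_lat: "u i \<in> int_lattice" if "i < m" for i
  proof -
    have "u i = (\<Sum>k<m. of_int (if k = i then 1 else 0) *\<^sub>R u k)"
      using that by (simp add: if_distrib[of "\<lambda>x. of_int x *\<^sub>R _"] if_distrib[of "\<lambda>x. x *\<^sub>R _"] cong: if_cong)
    then have "u i \<in> int_span m u"
      unfolding int_span_def by (rule image_eqI[where x="\<lambda>k. if k = i then 1 else 0"]) simp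
    then show ?thesis using regular by blast
  qed
  have "\<exists>v. (\<forall>j<k. v j \<in> int_lattice) \<and> (\<forall>i<k. \<forall>j<k. u i \<bullet> v j = (if i = j then 1 else 0))"
    if "k \<le> m" for k
    using that
  proof (induction k)
    case (Suc k)
    then obtain v where v: "\<And>j. j < k \<Longrightarrow> v j \<in> int_lattice"
      and dual: "\<And>i j. i < k \<Longrightarrow> j < k \<Longrightarrow> u i \<bullet> v j = (if i = j then 1 else 0)"
      by (metis Suc_leD)
    have k: "k < m" using Suc.prems by simp
    \<comment> \<open>The coefficients of \<open>u'\<close> in the full family, padded by 0 so that
      they can be compared with an integer combination of all \<open>u i\<close>. What matters below
      is \<open>b k = 1\<close>.\<close>
    define b where "b i = (if i = k then 1 else if i < k then - (u k \<bullet> v i) else 0)" for i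
    define u' where "u' = (\<Sum>i<m. b i *\<^sub>R u i)"
    have u'_eq: "u' = u k - (\<Sum>i<k. (u k \<bullet> v i) *\<^sub>R u i)"
    proof -
      have "u' = (\<Sum>i\<in>{..<Suc k}. b i *\<^sub>R u i)"
        unfolding u'_def using k by (intro sum.mono_neutral_right) (auto simp: b_def)
      also have "\<dots> = (\<Sum>i<k. b i *\<^sub>R u i) + u k" by (simp add: b_def)
      also have "(\<Sum>i<k. b i *\<^sub>R u i) = (\<Sum>i<k. - ((u k \<bullet> v i) *\<^sub>R u i))"
        by (rule sum.cong) (auto simp: b_def)
      finally show ?thesis by (simp add: sum_negf)
    qed
    have "u' \<in> int_lattice" unfolding u'_eq
      using k u_lat v by (intro int_lattice_diff int_lattice_sum int_lattice_scaleR int_lattice_inner) auto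
    moreover have "u' \<noteq> 0"
      using coeffs_eq_0[OF lin_indep, of b k] k by (auto simp: u'_def b_def)
    moreover have "d = 1" if d: "d > 0" "(1 / real d) *\<^sub>R u' \<in> int_lattice" for d :: nat
    proof -
      have "(1 / real d) *\<^sub>R u' \<in> span (u ` {..<m})"
        unfolding u'_def by (intro span_mul span_sum span_base) auto
      with d regular have "(1 / real d) *\<^sub>R u' \<in> int_span m u" by blast
      then obtain a :: "nat \<Rightarrow> int" where a: "(1 / real d) *\<^sub>R u' = (\<Sum>i<m. of_int (a i) *\<^sub>R u i)"
        unfolding int_span_def by blast
      have "(\<Sum>i<m. (b i / real d - of_int (a i)) *\<^sub>R u i) = (1 / real d) *\<^sub>R u' - (\<Sum>i<m. of_int (a i) *\<^sub>R u i)"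
        unfolding u'_def scaleR_sum_right by (simp add: scaleR_diff_left sum_subtractf)
      \<comment> \<open>By independence the two coefficients of \<open>u k\<close> agree:
        \<open>1 / d\<close> is the integer \<open>a k\<close>.\<close>
      then have "b k / real d - of_int (a k) = 0"
        using a k by (intro coeffs_eq_0[OF lin_indep]) auto
      then have "of_int (a k) * real d = 1" using d by (simp add: b_def field_simps)
      then have "a k * int d = 1"
        by (metis of_int_eq_1_iff of_int_mult of_int_of_nat_eq)
      then show "d = 1" using d by (simp add: zmult_eq_1_iff)
    qed
    ultimately obtain x0 where x0: "x0 \<in> int_lattice" "u' \<bullet> x0 = 1"
      using primitive_value by metis
    \<comment> \<open>Removes from \<open>x0\<close> the components seen by the earlier
      \<open>u i\<close>; the pairing of the result with \<open>u k\<close> is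
      \<open>u' \<bullet> x0 = 1\<close>.\<close>
    define w where "w = x0 - (\<Sum>i<k. (u i \<bullet> x0) *\<^sub>R v i)"
    have w: "w \<in> int_lattice"
      unfolding w_def using k u_lat v x0 by (intro int_lattice_diff int_lattice_sum int_lattice_scaleR int_lattice_inner) auto
    have ukw: "u k \<bullet> w = 1"
      using x0(2) by (simp add: w_def u'_eq inner_diff_right inner_diff_left inner_sum_left inner_sum_right mult.commute)
    have uiw: "u i \<bullet> w = 0" if "i < k" for i
    proof -
      have "(\<Sum>j<k. (u j \<bullet> x0) * (u i \<bullet> v j)) = (\<Sum>j<k. if j = i then u i \<bullet> x0 else 0)"
        using that by (intro sum.cong) (auto simp: dual)
      then show ?thesis using that by (simp add: w_def inner_diff_right inner_sum_right)
    qed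
    \<comment> \<open>Subtracting multiples of \<open>w\<close> makes the old vectors orthogonal to
      \<open>u k\<close>. Their pairings with the earlier \<open>u i\<close> are unchanged because
      \<open>u i \<bullet> w = 0\<close>.\<close>
    define v' where "v' = (\<lambda>j. if j = k then w else v j - (u k \<bullet> v j) *\<^sub>R w)"
    have "v' j \<in> int_lattice" if "j < Suc k" for j
      using that w v u_lat k by (auto simp: v'_def intro!: int_lattice_diff int_lattice_scaleR int_lattice_inner)
    moreover have "u i \<bullet> v' j = (if i = j then 1 else 0)" if "i < Suc k" "j < Suc k" for i j
      using that ukw uiw dual by (auto simp: v'_def inner_diff_right less_Suc_eq)
    ultimately show ?case by blast
  qed simp
  from this[of m] show ?thesis by simp
qed

section \<open>Directional derivatives of test functions\<close>

text \<open>The derivative occurring in \<open>Ck\<close>, with the direction first so that iterates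
  read \<open>dderiv v ^^ a\<close>.\<close>

definition dderiv :: "'a::euclidean_space \<Rightarrow> ('a \<Rightarrow> 'b::real_normed_vector) \<Rightarrow> 'a \<Rightarrow> 'b" where
  "dderiv v f = (\<lambda>x. frechet_derivative f (at x) v)"

lemma C0_infinity_continuous: "f \<in> C0_infinity \<Longrightarrow> continuous_on UNIV f"
  by (auto simp: C0_infinity_def dest: spec[of _ 0])

lemma C0_infinity_has_derivative:
  assumes "f \<in> C0_infinity"
  shows "(f has_derivative frechet_derivative f (at x)) (at x)"
proof -
  have "Ck (Suc 0) f" using assms by (auto simp: C0_infinity_def)
  then show ?thesis by (simp add: frechet_derivative_works)
qed

lemma dderiv_eq_0_outside:
  assumes "x \<notin> closure {x. f x \<noteq> 0}"
  shows "dderiv v f x = 0"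
proof -
  have "(f has_derivative (\<lambda>_. 0)) (at x)"
  proof (rule has_derivative_transform_within_open[of "\<lambda>_. 0"])
    show "open (- closure {x. f x \<noteq> 0})" by (intro open_Compl closed_closure)
    show "0 = f y" if "y \<in> - closure {x. f x \<noteq> 0}" for y
      using that closure_subset[of "{x. f x \<noteq> 0}"] by auto
  qed (use assms in auto)
  then have "frechet_derivative f (at x) = (\<lambda>_. 0)" by (metis frechet_derivative_at)
  then show ?thesis by (simp add: dderiv_def)
qed

lemma C0_infinity_dderiv:
  assumes "f \<in> C0_infinity"
  shows "dderiv v f \<in> C0_infinity"
proof -
  have "Ck k (dderiv v f)" for k
  proof -
    have "Ck (Suc k) f" using assms by (auto simp: C0_infinity_def)
    then show ?thesis by (simp add: dderiv_def)
  qed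
  moreover have "closure {x. dderiv v f x \<noteq> 0} \<subseteq> closure {x. f x \<noteq> 0}"
    by (rule closure_minimal) (use dderiv_eq_0_outside in auto)
  then have "compact (closure {x. dderiv v f x \<noteq> 0})"
    using compact_Int_closed[of "closure {x. f x \<noteq> 0}" "closure {x. dderiv v f x \<noteq> 0}"] assms
    by (simp add: Int_absorb1 C0_infinity_def)
  ultimately show ?thesis by (simp add: C0_infinity_def)
qed

lemma C0_infinity_dderiv_pow: "f \<in> C0_infinity \<Longrightarrow> (dderiv v ^^ a) f \<in> C0_infinity"
  by (induction a) (auto intro: C0_infinity_dderiv)

lemma C0_infinity_line:
  assumes "f \<in> C0_infinity"
  shows "((\<lambda>t. f (x + t *\<^sub>R v)) has_vector_derivative dderiv v f (x + t *\<^sub>R v)) (at t)"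
proof -
  have "((\<lambda>t. x + t *\<^sub>R v) has_derivative (\<lambda>t. t *\<^sub>R v)) (at t)"
    by (auto intro!: derivative_eq_intros)
  from has_derivative_compose[OF this C0_infinity_has_derivative[OF assms]]
  have "((\<lambda>t. f (x + t *\<^sub>R v)) has_derivative (\<lambda>s. frechet_derivative f (at (x + t *\<^sub>R v)) (s *\<^sub>R v))) (at t)" .
  moreover have "frechet_derivative f (at y) (s *\<^sub>R v) = s *\<^sub>R dderiv v f y" for y s
    using has_derivative_linear[OF C0_infinity_has_derivative[OF assms]]
    by (simp add: dderiv_def linear_cmul)
  ultimately show ?thesis by (simp add: has_vector_derivative_def)
qed

text \<open>One radius serves \<open>f\<close> and all its directional derivatives, since the latter
  vanish off the closed support of \<open>f\<close>.\<close>

lemma C0_infinity_support: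
  assumes "f \<in> C0_infinity"
  obtains r where "r > 0" "\<And>x. f x \<noteq> 0 \<Longrightarrow> norm x \<le> r" "\<And>v x. dderiv v f x \<noteq> 0 \<Longrightarrow> norm x \<le> r"
proof -
  have "bounded (closure {x. f x \<noteq> 0})" using assms by (auto simp: C0_infinity_def compact_imp_bounded)
  then obtain r where r: "r > 0" "\<And>x. x \<in> closure {x. f x \<noteq> 0} \<Longrightarrow> norm x \<le> r"
    by (auto simp: bounded_pos)
  show ?thesis
  proof (rule that[OF r(1)])
    show "f x \<noteq> 0 \<Longrightarrow> norm x \<le> r" for x
      using r(2)[of x] closure_subset[of "{x. f x \<noteq> 0}"] by auto
    show "dderiv v f x \<noteq> 0 \<Longrightarrow> norm x \<le> r" for v x
      using r(2)[of x] dderiv_eq_0_outside[of x f v] by auto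
  qed
qed

lemma C0_infinity_bounded:
  assumes "f \<in> C0_infinity"
  obtains B where "B \<ge> 0" "\<And>x. norm (f x) \<le> B"
proof -
  have "bounded (f ` closure {x. f x \<noteq> 0})"
    using assms by (intro compact_imp_bounded compact_continuous_image continuous_on_subset[OF C0_infinity_continuous])
      (auto simp: C0_infinity_def)
  then obtain B where B: "B > 0" "\<And>x. x \<in> closure {x. f x \<noteq> 0} \<Longrightarrow> norm (f x) \<le> B"
    by (auto simp: bounded_pos)
  have "norm (f x) \<le> B" for x
    using B closure_subset[of "{x. f x \<noteq> 0}"] by (cases "f x = 0") auto
  with B show ?thesis by (intro that[of B]) auto
qed

section \<open>Lattice sums\<close>

lemma card_int_interval_le:
  fixes z \<rho> :: real
  assumes "\<rho> \<ge> 0"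
  shows "finite {i::int. \<bar>of_int i + z\<bar> \<le> \<rho>}" "real (card {i::int. \<bar>of_int i + z\<bar> \<le> \<rho>}) \<le> 2 * \<rho> + 1"
proof -
  have eq: "{i::int. \<bar>of_int i + z\<bar> \<le> \<rho>} = {\<lceil>- \<rho> - z\<rceil>..\<lfloor>\<rho> - z\<rfloor>}"
    by (auto simp: abs_le_iff ceiling_le_iff le_floor_iff)
  show "finite {i::int. \<bar>of_int i + z\<bar> \<le> \<rho>}" unfolding eq by simp
  show "real (card {i::int. \<bar>of_int i + z\<bar> \<le> \<rho>}) \<le> 2 * \<rho> + 1"
  proof (cases "\<lfloor>\<rho> - z\<rfloor> + 1 - \<lceil>- \<rho> - z\<rceil> \<ge> 0")
    case True
    then have "real (card {\<lceil>- \<rho> - z\<rceil>..\<lfloor>\<rho> - z\<rfloor>}) = of_int (\<lfloor>\<rho> - z\<rfloor> + 1 - \<lceil>- \<rho> - z\<rceil>)" by simp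
    also have "\<dots> \<le> 2 * \<rho> + 1"
      using of_int_floor_le[of "\<rho> - z"] le_of_int_ceiling[of "- \<rho> - z"] by linarith
    finally show ?thesis unfolding eq .
  next
    case False
    then show ?thesis unfolding eq using assms by simp
  qed
qed

text \<open>Each coordinate of \<open>k\<close> lies in an interval of length
  \<open>2 * \<rho>\<close>, which holds at most \<open>2 * \<rho> + 1\<close> integers. The bound
  is uniform in \<open>z\<close>.\<close>

lemma card_int_lattice_le:
  fixes z :: "real ^ 'n"
  assumes "\<rho> \<ge> 0"
  shows "finite {k \<in> int_lattice. norm (k + z) \<le> \<rho>}"
    "real (card {k \<in> int_lattice. norm (k + z) \<le> \<rho>}) \<le> (2 * \<rho> + 1) ^ CARD('n)"
proof -
  define T where "T = (\<lambda>j. {i::int. \<bar>of_int i + z $ j\<bar> \<le> \<rho>})"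
  let ?A = "{k \<in> int_lattice. norm (k + z) \<le> \<rho>}"
  have sub: "(\<lambda>k j. \<lfloor>k $ j\<rfloor>) ` ?A \<subseteq> PiE UNIV T"
  proof (rule image_subsetI)
    fix k assume k: "k \<in> ?A"
    have "\<bar>of_int \<lfloor>k $ j\<rfloor> + z $ j\<bar> \<le> \<rho>" for j
    proof -
      have fl: "of_int \<lfloor>k $ j\<rfloor> = k $ j" using k by (simp add: int_lattice_def)
      show ?thesis
        unfolding fl using component_le_norm_cart[of "k + z" j] k by simp
    qed
    then show "(\<lambda>j. \<lfloor>k $ j\<rfloor>) \<in> PiE UNIV T" by (auto simp: T_def)
  qed
  have inj: "inj_on (\<lambda>k j. \<lfloor>k $ j\<rfloor>) ?A"
  proof (rule inj_onI)
    fix k l assume kl: "k \<in> ?A" "l \<in> ?A" and eq: "(\<lambda>j. \<lfloor>k $ j\<rfloor>) = (\<lambda>j. \<lfloor>l $ j\<rfloor>)"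
    have "k $ j = l $ j" for j
      using fun_cong[OF eq, of j] kl by (auto simp: int_lattice_def elim!: Ints_cases dest!: spec[of _ j])
    then show "k = l" by (simp add: vec_eq_iff)
  qed
  have fin: "finite (PiE UNIV T)"
    by (intro finite_PiE) (auto simp: T_def card_int_interval_le assms)
  show "finite ?A" using finite_subset[OF sub fin] inj finite_image_iff by blast
  have "real (card ?A) = real (card ((\<lambda>k j. \<lfloor>k $ j\<rfloor>) ` ?A))" by (simp add: card_image[OF inj])
  also have "\<dots> \<le> real (card (PiE UNIV T))" using card_mono[OF fin sub] by simp
  also have "\<dots> = (\<Prod>j\<in>(UNIV::'n set). real (card (T j)))" by (simp add: card_PiE)
  also have "\<dots> \<le> (\<Prod>j\<in>(UNIV::'n set). 2 * \<rho> + 1)"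
    by (intro prod_mono) (auto simp: T_def intro: card_int_interval_le assms)
  finally show "real (card ?A) \<le> (2 * \<rho> + 1) ^ CARD('n)" by simp
qed

text \<open>The function \<open>\<sigma>\<^sub>f\<close> for an arbitrary index set, since the basic
  estimates are uniform in \<open>S\<close>. For compactly supported \<open>f\<close>,
  \<open>S\<close> in the lattice and \<open>N \<ge> 1\<close> only finitely many terms are
  nonzero.\<close>

definition lattice_sum :: "(real ^ 'n) set \<Rightarrow> nat \<Rightarrow> (real ^ 'n \<Rightarrow> complex) \<Rightarrow> real ^ 'n \<Rightarrow> complex" where
  "lattice_sum S N f z = (\<Sum>\<^sub>\<infinity>k\<in>S. f ((k + z) /\<^sub>R real N)) / of_nat N ^ CARD('n)"

text \<open>The index set depends on \<open>z0\<close> and \<open>R\<close> but not on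
  \<open>z\<close>, so a single finite sum represents the function on a whole ball. Continuity and
  differentiability thus reduce to finite sums.\<close>

lemma lattice_sum_finite:
  fixes f :: "real ^ 'n \<Rightarrow> complex"
  assumes supp: "\<And>x. f x \<noteq> 0 \<Longrightarrow> norm x \<le> r" and N: "N \<ge> 1" and z: "norm (z - z0) \<le> R"
    and S: "S \<subseteq> int_lattice" and r: "r \<ge> 0"
  shows "lattice_sum S N f z =
    (\<Sum>k\<in>{k \<in> int_lattice. norm (k + z0) \<le> real N * r + R} \<inter> S. f ((k + z) /\<^sub>R real N)) / of_nat N ^ CARD('n)"
proof -
  have R: "R \<ge> 0" using z norm_ge_zero order_trans by blast
  let ?K = "{k \<in> int_lattice. norm (k + z0) \<le> real N * r + R} \<inter> S"
  have "finite ?K" using card_int_lattice_le(1)[of "real N * r + R" z0] r R by auto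
  have "(\<Sum>\<^sub>\<infinity>k\<in>S. f ((k + z) /\<^sub>R real N)) = (\<Sum>\<^sub>\<infinity>k\<in>?K. f ((k + z) /\<^sub>R real N))"
  proof (rule infsum_cong_neutral)
    fix k assume k: "k \<in> S - ?K"
    show "f ((k + z) /\<^sub>R real N) = 0"
    proof (rule ccontr)
      assume "f ((k + z) /\<^sub>R real N) \<noteq> 0"
      from supp[OF this] have "norm (k + z) / real N \<le> r"
        by (simp only: norm_scaleR abs_inverse abs_of_nat divide_inverse_commute)
      then have "norm (k + z) \<le> real N * r"
        using N by (simp add: field_simps)
      then have "norm (k + z0) \<le> real N * r + R"
        using z norm_triangle_ineq4[of "k + z" "z - z0"] by (simp add: algebra_simps)
      with k S show False by auto
    qed
  qed auto
  then show ?thesis using \<open>finite ?K\<close> by (simp add: lattice_sum_def)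
qed

text \<open>There are at most \<open>(2 * r * N + 1) ^ n\<close> nonzero terms, where
  \<open>n = CARD('n)\<close>; the normalisation by \<open>N ^ n\<close> cancels this growth. The
  constant depends on \<open>f\<close> alone.\<close>

lemma lattice_sum_bounded:
  fixes f :: "real ^ 'n \<Rightarrow> complex"
  assumes f: "f \<in> C0_infinity"
  obtains C where "C \<ge> 0" "\<And>S N z. S \<subseteq> int_lattice \<Longrightarrow> N \<ge> 1 \<Longrightarrow> norm (lattice_sum S N f z) \<le> C"
proof -
  obtain r where r: "r > 0" "\<And>x. f x \<noteq> 0 \<Longrightarrow> norm x \<le> r" using C0_infinity_support[OF f] by metis
  obtain B where B: "B \<ge> 0" "\<And>x. norm (f x) \<le> B" using C0_infinity_bounded[OF f] by metis
  show ?thesis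
  proof (rule that[of "(2 * r + 1) ^ CARD('n) * B"])
    fix S :: "(real ^ 'n) set" and N :: nat and z :: "real ^ 'n"
    assume S: "S \<subseteq> int_lattice" and N: "N \<ge> 1"
    let ?A = "{k \<in> int_lattice. norm (k + z) \<le> real N * r}"
    let ?K = "?A \<inter> S"
    have fin: "finite ?A" and card: "real (card ?A) \<le> (2 * (real N * r) + 1) ^ CARD('n)"
      using card_int_lattice_le[of "real N * r" z] r by auto
    have "norm (\<Sum>k\<in>?K. f ((k + z) /\<^sub>R real N)) \<le> real (card ?K) * B"
      by (rule order_trans[OF norm_sum sum_bounded_above]) (use B in auto)
    also have "\<dots> \<le> real (card ?A) * B"
      using B card_mono[OF fin, of ?K] by (intro mult_right_mono) auto
    also have "\<dots> \<le> (2 * (real N * r) + 1) ^ CARD('n) * B"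
      using B card by (intro mult_right_mono)
    also have "\<dots> \<le> ((2 * r + 1) * real N) ^ CARD('n) * B"
      using B r N by (intro mult_right_mono power_mono) (auto simp: algebra_simps)
    finally have "norm (\<Sum>k\<in>?K. f ((k + z) /\<^sub>R real N)) / real N ^ CARD('n) \<le> (2 * r + 1) ^ CARD('n) * B"
      unfolding power_mult_distrib using N by (simp add: divide_le_eq mult_ac)
    then show "norm (lattice_sum S N f z) \<le> (2 * r + 1) ^ CARD('n) * B"
      using lattice_sum_finite[of f r N z z 0 S] r N S
      by (simp add: norm_divide norm_power)
  qed (use r B in auto)
qed

text \<open>The argument of \<open>f\<close> moves at speed \<open>w / N\<close>, hence the gain of
  \<open>1 / N\<close>.\<close>

lemma lattice_sum_line:
  fixes f :: "real ^ 'n \<Rightarrow> complex"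
  assumes f: "f \<in> C0_infinity" and S: "S \<subseteq> int_lattice" and N: "N \<ge> 1"
  shows "((\<lambda>s. lattice_sum S N f (z + s *\<^sub>R w)) has_vector_derivative
      (1 / real N) *\<^sub>R lattice_sum S N (dderiv w f) (z + s *\<^sub>R w)) (at s)"
proof -
  obtain r where r: "r > 0" "\<And>x. f x \<noteq> 0 \<Longrightarrow> norm x \<le> r" "\<And>x. dderiv w f x \<noteq> 0 \<Longrightarrow> norm x \<le> r"
    using C0_infinity_support[OF f] by metis
  \<comment> \<open>The margin \<open>norm w\<close> makes these indices sufficient for all
    parameters at distance below 1 from \<open>s\<close>.\<close>
  define K where "K = {k \<in> int_lattice. norm (k + (z + s *\<^sub>R w)) \<le> real N * r + norm w} \<inter> S"
  have line: "((\<lambda>s. f ((k + (z + s *\<^sub>R w)) /\<^sub>R real N)) has_vector_derivative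
        (1 / real N) *\<^sub>R dderiv w f ((k + (z + s *\<^sub>R w)) /\<^sub>R real N)) (at s)" for k
  proof -
    have "((\<lambda>s. s / real N) has_vector_derivative (1 / real N)) (at s)"
      using DERIV_cdivide[OF DERIV_ident, of "real N"] by (simp only: has_real_derivative_iff_has_vector_derivative)
    from vector_diff_chain_at[OF this C0_infinity_line[OF f, of "(k + z) /\<^sub>R real N" w "s / real N"]]
    show ?thesis by (simp add: o_def scaleR_add_right add.assoc divide_inverse mult.commute)
  qed
  have "((\<lambda>s. (\<Sum>k\<in>K. f ((k + (z + s *\<^sub>R w)) /\<^sub>R real N)) / of_nat N ^ CARD('n)) has_vector_derivative
       (\<Sum>k\<in>K. (1 / real N) *\<^sub>R dderiv w f ((k + (z + s *\<^sub>R w)) /\<^sub>R real N)) / of_nat N ^ CARD('n)) (at s)"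
    unfolding divide_inverse
    by (intro has_vector_derivative_mult_left has_vector_derivative_sum) (use line in \<open>simp add: divide_inverse\<close>)
  also have "(\<Sum>k\<in>K. (1 / real N) *\<^sub>R dderiv w f ((k + (z + s *\<^sub>R w)) /\<^sub>R real N)) / of_nat N ^ CARD('n)
     = (1 / real N) *\<^sub>R lattice_sum S N (dderiv w f) (z + s *\<^sub>R w)"
    using lattice_sum_finite[of "dderiv w f" r N "z + s *\<^sub>R w" "z + s *\<^sub>R w" "norm w" S] r S N
    by (simp add: K_def scaleR_sum_right[symmetric] divide_inverse[where 'a=complex])
  finally show ?thesis
  proof (rule has_vector_derivative_transform_within_open[where S="ball s 1"])
    fix t assume "t \<in> ball s 1"
    then have "norm (z + t *\<^sub>R w - (z + s *\<^sub>R w)) \<le> norm w"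
      by (simp add: dist_real_def mult_left_le_one_le abs_minus_commute flip: scaleR_diff_left)
    from lattice_sum_finite[OF r(2) N this S]
    show "(\<Sum>k\<in>K. f ((k + (z + t *\<^sub>R w)) /\<^sub>R real N)) / of_nat N ^ CARD('n) = lattice_sum S N f (z + t *\<^sub>R w)"
      using r by (simp add: K_def)
  qed auto
qed

lemma continuous_lattice_sum:
  fixes f :: "real ^ 'n \<Rightarrow> complex"
  assumes f: "f \<in> C0_infinity" and S: "S \<subseteq> int_lattice" and N: "N \<ge> 1"
  shows "continuous_on UNIV (lattice_sum S N f)"
proof -
  obtain r where r: "r > 0" "\<And>x. f x \<noteq> 0 \<Longrightarrow> norm x \<le> r" using C0_infinity_support[OF f] by metis
  have "isCont (lattice_sum S N f) z" for z
  proof -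
    define K where "K = {k \<in> int_lattice. norm (k + z) \<le> real N * r + 1} \<inter> S"
    have "continuous_on UNIV (\<lambda>y. (\<Sum>k\<in>K. f ((k + y) /\<^sub>R real N)) / of_nat N ^ CARD('n))"
      using N by (intro continuous_intros continuous_on_compose2[OF C0_infinity_continuous[OF f]]) auto
    then have "isCont (\<lambda>y. (\<Sum>k\<in>K. f ((k + y) /\<^sub>R real N)) / of_nat N ^ CARD('n)) z"
      by (simp add: continuous_on_eq_continuous_at)
    moreover have "\<forall>\<^sub>F y in nhds z. (\<Sum>k\<in>K. f ((k + y) /\<^sub>R real N)) / of_nat N ^ CARD('n) = lattice_sum S N f y"
    proof -
      have "\<forall>\<^sub>F y in nhds z. y \<in> ball z 1" by (intro eventually_nhds_in_open) auto
      then show ?thesis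
      proof eventually_elim
        case (elim y)
        then have "norm (y - z) \<le> 1" by (simp add: dist_norm norm_minus_commute)
        from lattice_sum_finite[OF r(2) N this S] show ?case
          using r by (simp add: K_def)
      qed
    qed
    ultimately show ?thesis by (simp add: isCont_cong)
  qed
  then show ?thesis by (simp add: continuous_on_eq_continuous_at)
qed

lemma lattice_sum_periodic:
  assumes "\<And>k. k \<in> S \<Longrightarrow> k + l \<in> S" "\<And>k. k \<in> S \<Longrightarrow> k - l \<in> S"
  shows "lattice_sum S N f (z + l) = lattice_sum S N f z"
proof -
  have "bij_betw (\<lambda>k. k + l) S S"
    by (rule bij_betw_byWitness[where f'="\<lambda>k. k - l"]) (use assms in auto)
  from infsum_reindex_bij_betw[OF this, of "\<lambda>k. f ((k + z) /\<^sub>R real N)"]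
  show ?thesis by (simp add: lattice_sum_def algebra_simps)
qed

section \<open>Integration over the unit cube\<close>

text \<open>Half open, so that the lattice translates partition the space without overlap.\<close>

definition unit_cube :: "(real ^ 'n) set" where
  "unit_cube = {y. \<forall>j. 0 \<le> y $ j \<and> y $ j < 1}"

definition lattice_floor :: "real ^ 'n \<Rightarrow> real ^ 'n" where
  "lattice_floor y = (\<chi> j. of_int \<lfloor>y $ j\<rfloor>)"

lemma lattice_floor_int: "lattice_floor y \<in> int_lattice"
  by (simp add: lattice_floor_def int_lattice_def)

lemma unit_cube_iff_floor:
  assumes "k \<in> int_lattice"
  shows "y - k \<in> unit_cube \<longleftrightarrow> k = lattice_floor y"
proof
  assume *: "y - k \<in> unit_cube"
  show "k = lattice_floor y"
    unfolding vec_eq_iff lattice_floor_def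
  proof
    fix j
    obtain n :: int where n: "k $ j = of_int n" using assms by (auto simp: int_lattice_def elim: Ints_cases)
    have "0 \<le> y $ j - of_int n" "y $ j - of_int n < 1"
      using * n by (auto simp: unit_cube_def dest!: spec[of _ j])
    then have "\<lfloor>y $ j\<rfloor> = n" by (intro floor_unique) auto
    then show "k $ j = (\<chi> j. of_int \<lfloor>y $ j\<rfloor>) $ j" using n by simp
  qed
next
  assume k: "k = lattice_floor y"
  show "y - k \<in> unit_cube"
    unfolding unit_cube_def k lattice_floor_def by (auto, linarith)
qed

lemma norm_unit_cube_le: "y \<in> unit_cube \<Longrightarrow> norm (y :: real ^ 'n) \<le> CARD('n)"
proof -
  assume y: "y \<in> unit_cube"
  have "norm y \<le> (\<Sum>j\<in>UNIV. \<bar>y $ j\<bar>)" by (rule norm_le_l1_cart)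
  also have "\<dots> \<le> (\<Sum>j\<in>(UNIV::'n set). 1)"
    using y by (intro sum_mono) (auto simp: unit_cube_def intro: less_imp_le)
  finally show ?thesis by simp
qed

lemma unit_cube_borel [measurable]: "(unit_cube :: (real ^ 'n) set) \<in> sets borel"
  unfolding unit_cube_def by measurable

text \<open>Squeezed between the open and the closed box, which have equal measure.\<close>

lemma measure_unit_cube: "measure lborel (unit_cube :: (real ^ 'n) set) = 1"
proof -
  have "emeasure lborel (unit_cube :: (real ^ 'n) set) = emeasure lborel (cbox 0 (\<chi> j. 1) :: (real ^ 'n) set)"
  proof (rule antisym)
    show "emeasure lborel (unit_cube :: (real ^ 'n) set) \<le> emeasure lborel (cbox 0 (\<chi> j. 1) :: (real ^ 'n) set)"
      by (rule emeasure_mono) (auto simp: unit_cube_def mem_box_cart less_imp_le)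
    have "emeasure lborel (cbox 0 (\<chi> j. 1) :: (real ^ 'n) set) = emeasure lborel (box 0 (\<chi> j. 1) :: (real ^ 'n) set)"
      by (simp add: emeasure_lborel_cbox_eq emeasure_lborel_box_eq Basis_vec_def inner_axis)
    also have "\<dots> \<le> emeasure lborel (unit_cube :: (real ^ 'n) set)"
      by (rule emeasure_mono) (auto simp: unit_cube_def mem_box_cart less_imp_le)
    finally show "emeasure lborel (cbox 0 (\<chi> j. 1) :: (real ^ 'n) set) \<le> emeasure lborel (unit_cube :: (real ^ 'n) set)" .
  qed
  also have "\<dots> = 1"
  proof -
    have "(\<Prod>b\<in>(Basis :: (real ^ 'n) set). (\<chi> j. 1) \<bullet> b) = 1"
      by (intro prod.neutral) (auto simp: Basis_vec_def inner_axis)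
    then show ?thesis
      by (simp add: emeasure_lborel_cbox_eq) (auto simp: Basis_vec_def inner_axis)
  qed
  finally show ?thesis by (simp add: measure_def)
qed

lemma lborel_integral_translate:
  fixes g :: "'a::euclidean_space \<Rightarrow> 'b::{banach,second_countable_topology}"
  assumes [measurable]: "g \<in> borel_measurable borel"
  shows "(LINT x|lborel. g (c + x)) = (LINT x|lborel. g x)"
  by (subst (2) lborel_distr_plus[of c, symmetric]) (simp add: integral_distr)

lemma lborel_integrable_translate:
  fixes g :: "'a::euclidean_space \<Rightarrow> 'b::{banach,second_countable_topology}"
  assumes "integrable lborel g"
  shows "integrable lborel (\<lambda>x. g (c + x))"
proof -
  have [measurable]: "g \<in> borel_measurable borel" using assms by auto
  have "integrable (distr lborel borel ((+) c)) g" using assms by (simp add: lborel_distr_plus)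
  then show ?thesis by (simp add: integrable_distr_eq)
qed

text \<open>Exactly one lattice translate of the cube contains \<open>x\<close>, the one at
  \<open>lattice_floor x\<close>; the others contribute 0.\<close>

lemma lattice_sum_floor_indicator:
  fixes G :: "real ^ 'n \<Rightarrow> 'b::real_normed_vector"
  assumes K: "finite K" "K \<subseteq> int_lattice" and supp: "G x \<noteq> 0 \<Longrightarrow> lattice_floor x \<in> K"
  shows "(\<Sum>k\<in>K. indicat_real unit_cube (x - k) *\<^sub>R G x) = G x"
proof (cases "G x = 0")
  case False
  have "(\<Sum>k\<in>K. indicat_real unit_cube (x - k) *\<^sub>R G x) = (\<Sum>k\<in>K. if k = lattice_floor x then G x else 0)"
    using K unit_cube_iff_floor by (intro sum.cong) (auto simp: indicator_def)
  then show ?thesis using supp[OF False] K by simp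
qed simp

lemma norm_lattice_floor_le: "norm (lattice_floor x) \<le> norm x + CARD('n)" for x :: "real ^ 'n"
proof -
  have "x - lattice_floor x \<in> unit_cube"
    by (simp add: unit_cube_iff_floor lattice_floor_int)
  from norm_unit_cube_le[OF this] show ?thesis
    using norm_triangle_sub[of "lattice_floor x" x] by (simp add: norm_minus_commute)
qed

text \<open>Cut the space into translates of the cube and move every piece back. Bounded support
  leaves finitely many pieces, so sum and integral commute.\<close>

lemma integral_periodization:
  fixes H :: "real ^ 'n \<Rightarrow> complex"
  assumes int: "integrable lborel H" and supp: "\<And>x. H x \<noteq> 0 \<Longrightarrow> norm x \<le> r"
  shows "(LINT x|lborel. H x) = (LINT y:unit_cube|lborel. (\<Sum>\<^sub>\<infinity>k\<in>int_lattice. H (k + y)))"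
proof -
  have [measurable]: "H \<in> borel_measurable borel" using int by auto
  \<comment> \<open>By \<open>norm_lattice_floor_le\<close> the corner of the cell of
    \<open>x\<close> exceeds \<open>x\<close> in norm by at most \<open>CARD('n)\<close>; the
    absolute value keeps the radius nonnegative.\<close>
  define K where "K = {k \<in> int_lattice :: (real ^ 'n) set. norm k \<le> \<bar>r\<bar> + CARD('n)}"
  have K: "finite K" "K \<subseteq> int_lattice"
    using card_int_lattice_le(1)[of "\<bar>r\<bar> + CARD('n)" "0 :: real ^ 'n"] by (auto simp: K_def)
  have "lattice_floor x \<in> K" if "H x \<noteq> 0" for x
    using supp[OF that] norm_lattice_floor_le[of x] by (auto simp: K_def lattice_floor_int)
  note split = lattice_sum_floor_indicator[OF K this]
  have int': "integrable lborel (\<lambda>x. indicat_real unit_cube (x - k) *\<^sub>R H x)" for k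
    by (rule Bochner_Integration.integrable_bound[OF int]) (auto simp: indicator_def)
  then have int'': "integrable lborel (\<lambda>y. indicat_real unit_cube y *\<^sub>R H (k + y))" for k
    using lborel_integrable_translate[OF int'[of k], of k] by simp
  have "(LINT x|lborel. H x) = (LINT x|lborel. (\<Sum>k\<in>K. indicat_real unit_cube (x - k) *\<^sub>R H x))"
    by (simp add: split)
  also have "\<dots> = (\<Sum>k\<in>K. LINT x|lborel. indicat_real unit_cube (x - k) *\<^sub>R H x)"
    by (intro Bochner_Integration.integral_sum int')
  also have "\<dots> = (\<Sum>k\<in>K. LINT y|lborel. indicat_real unit_cube y *\<^sub>R H (k + y))"
  proof (rule sum.cong)
    fix k
    show "(LINT x|lborel. indicat_real unit_cube (x - k) *\<^sub>R H x) = (LINT y|lborel. indicat_real unit_cube y *\<^sub>R H (k + y))"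
      by (subst lborel_integral_translate[of _ k, symmetric]) auto
  qed simp
  also have "\<dots> = (LINT y|lborel. (\<Sum>k\<in>K. indicat_real unit_cube y *\<^sub>R H (k + y)))"
    by (intro Bochner_Integration.integral_sum[symmetric] int'')
  also have "\<dots> = (LINT y:unit_cube|lborel. (\<Sum>\<^sub>\<infinity>k\<in>int_lattice. H (k + y)))"
    unfolding set_lebesgue_integral_def
  proof (rule Bochner_Integration.integral_cong)
    fix y :: "real ^ 'n"
    show "(\<Sum>k\<in>K. indicat_real unit_cube y *\<^sub>R H (k + y)) = indicat_real unit_cube y *\<^sub>R (\<Sum>\<^sub>\<infinity>k\<in>int_lattice. H (k + y))"
    proof (cases "y \<in> unit_cube")
      case True
      have "(\<Sum>\<^sub>\<infinity>k\<in>int_lattice. H (k + y)) = (\<Sum>\<^sub>\<infinity>k\<in>K. H (k + y))"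
      proof (rule infsum_cong_neutral)
        fix k assume k: "k \<in> int_lattice - K"
        show "H (k + y) = 0"
        proof (rule ccontr)
          assume "H (k + y) \<noteq> 0"
          then have "norm k \<le> \<bar>r\<bar> + CARD('n)"
            using supp[of "k + y"] norm_unit_cube_le[OF True] norm_triangle_ineq4[of "k + y" y] by simp
          with k show False by (simp add: K_def)
        qed
      qed (use K in auto)
      then show ?thesis using K True by (simp add: scaleR_sum_right)
    qed simp
  qed simp
  finally show ?thesis .
qed

lemma finite_emeasure_unit_cube: "emeasure lborel (unit_cube :: (real ^ 'n) set) < \<infinity>"
proof -
  have "bounded (unit_cube :: (real ^ 'n) set)"
    using norm_unit_cube_le unfolding bounded_iff by blast
  then show ?thesis by (rule emeasure_bounded_finite)
qed

lemma set_integrable_unit_cube: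
  fixes H :: "real ^ 'n \<Rightarrow> complex"
  assumes [measurable]: "H \<in> borel_measurable borel" and "\<And>y. norm (H y) \<le> B"
  shows "set_integrable lborel unit_cube H"
  unfolding set_integrable_def
  by (rule integrableI_bounded_set_indicator[of _ _ _ B]) (use assms finite_emeasure_unit_cube in auto)

text \<open>The translated cube is another fundamental domain of the lattice: periodising
  \<open>H\<close> cut off to it gives back \<open>H\<close>.\<close>

lemma integral_unit_cube_translate:
  fixes H :: "real ^ 'n \<Rightarrow> complex"
  assumes [measurable]: "H \<in> borel_measurable borel" and bd: "\<And>y. norm (H y) \<le> B"
    and per: "\<And>y l. l \<in> int_lattice \<Longrightarrow> H (y + l) = H y"
  shows "(LINT y:unit_cube|lborel. H (y + a)) = (LINT y:unit_cube|lborel. H y)"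
proof -
  define G where "G = (\<lambda>x. indicat_real unit_cube (x - a) *\<^sub>R H x)"
  have "set_integrable lborel unit_cube (\<lambda>y. H (y + a))"
    by (rule set_integrable_unit_cube) (use bd in auto)
  then have "integrable lborel (\<lambda>y. indicat_real unit_cube y *\<^sub>R H (y + a))"
    by (simp add: set_integrable_def)
  from lborel_integrable_translate[OF this, of "-a"] have G: "integrable lborel G"
    by (simp add: G_def)
  have "(LINT y:unit_cube|lborel. H (y + a)) = (LINT x|lborel. G x)"
    unfolding set_lebesgue_integral_def G_def
    by (subst (2) lborel_integral_translate[of _ a, symmetric]) (auto simp: add.commute)
  also have "\<dots> = (LINT y:unit_cube|lborel. (\<Sum>\<^sub>\<infinity>k\<in>int_lattice. G (k + y)))"
  proof (rule integral_periodization[OF G])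
    fix x assume "G x \<noteq> 0"
    then have "x - a \<in> unit_cube" by (auto simp: G_def indicator_def split: if_splits)
    from norm_unit_cube_le[OF this] show "norm x \<le> norm a + CARD('n)"
      using norm_triangle_sub[of x a] by simp
  qed
  also have "(\<lambda>y. \<Sum>\<^sub>\<infinity>k\<in>int_lattice. G (k + y)) = H"
  proof
    fix y
    \<comment> \<open>The only lattice vector that carries \<open>y\<close> into the cube translated
      by \<open>a\<close>.\<close>
    define k0 where "k0 = - lattice_floor (y - a)"
    have k0: "k0 \<in> int_lattice"
      using int_lattice_diff[OF int_lattice_0 lattice_floor_int] by (simp add: k0_def)
    have "G (k + y) = (if k = k0 then H y else 0)" if k: "k \<in> int_lattice" for k
    proof -
      have "-k \<in> int_lattice" using int_lattice_diff[OF int_lattice_0 k] by simp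
      from unit_cube_iff_floor[OF this, of "y - a"] have "k + y - a \<in> unit_cube \<longleftrightarrow> k = k0"
        unfolding k0_def by (simp add: algebra_simps minus_equation_iff) (metis minus_minus)
      moreover have "H (k + y) = H y" using per[OF k, of y] by (simp add: add.commute)
      ultimately show ?thesis by (auto simp: G_def indicator_def)
    qed
    then have "(\<Sum>\<^sub>\<infinity>k\<in>int_lattice. G (k + y)) = (\<Sum>\<^sub>\<infinity>k\<in>{k0}. H y)"
      by (intro infsum_cong_neutral) (use k0 in auto)
    then show "(\<Sum>\<^sub>\<infinity>k\<in>int_lattice. G (k + y)) = H y" by simp
  qed
  finally show ?thesis .
qed

text \<open>As \<open>t\<close> runs through \<open>[0, 1]\<close>, the argument of \<open>q\<close>
  runs down from \<open>\<rho>\<close> to 0, jumps to 1 where \<open>a + t\<close> passes an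
  integer, and runs down to \<open>\<rho>\<close>. The two reflected pieces make up
  \<open>[0, 1]\<close>.\<close>

lemma integral_frac_shift:
  fixes q :: "real \<Rightarrow> complex"
  assumes cont: "continuous_on UNIV q"
  shows "((\<lambda>t. q (of_int \<lceil>a + t\<rceil> - (a + t))) has_integral integral {0..1} q) {0..1}"
proof -
  define \<rho> where "\<rho> = of_int \<lceil>a\<rceil> - a"
  have \<rho>: "0 \<le> \<rho>" "\<rho> < 1" unfolding \<rho>_def by linarith+
  have cont': "continuous_on S q" for S using cont continuous_on_subset by blast
  have refl: "((\<lambda>t. q (d - t)) has_integral integral {d - y..d - x} q) {x..y}" if "x \<le> y" for x y d
  proof -
    have "(q has_integral integral {d - y..d - x} q) (cbox (d - y) (d - x))"
      unfolding cbox_interval by (intro integrable_integral integrable_continuous_real cont')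
    from has_integral_affinity[OF this, of "-1" d] show ?thesis
      using that by (simp add: image_affinity_cbox cbox_interval)
  qed
  have 1: "((\<lambda>t. q (of_int \<lceil>a + t\<rceil> - (a + t))) has_integral integral {0..\<rho>} q) {0..\<rho>}"
  proof (rule has_integral_spike_finite[of "{0}"])
    show "((\<lambda>t. q (\<rho> - t)) has_integral integral {0..\<rho>} q) {0..\<rho>}"
      using refl[of 0 \<rho> \<rho>] \<rho> by simp
    fix t assume t: "t \<in> {0..\<rho>} - {0}"
    then have "\<lceil>a + t\<rceil> = \<lceil>a\<rceil>" unfolding \<rho>_def by (intro ceiling_unique) (auto, linarith)
    then show "q (of_int \<lceil>a + t\<rceil> - (a + t)) = q (\<rho> - t)" by (simp add: \<rho>_def algebra_simps)
  qed simp
  \<comment> \<open>At \<open>t = \<rho>\<close> the ceiling is still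
    \<open>\<lceil>a\<rceil>\<close>; the integral does not see this single point.\<close>
  have 2: "((\<lambda>t. q (of_int \<lceil>a + t\<rceil> - (a + t))) has_integral integral {\<rho>..1} q) {\<rho>..1}"
  proof (rule has_integral_spike_finite[of "{\<rho>}"])
    show "((\<lambda>t. q (\<rho> + 1 - t)) has_integral integral {\<rho>..1} q) {\<rho>..1}"
      using refl[of \<rho> 1 "\<rho> + 1"] \<rho> by simp
    fix t assume t: "t \<in> {\<rho>..1} - {\<rho>}"
    then have "\<lceil>a + t\<rceil> = \<lceil>a\<rceil> + 1" unfolding \<rho>_def by (intro ceiling_unique) (auto, linarith)
    then show "q (of_int \<lceil>a + t\<rceil> - (a + t)) = q (\<rho> + 1 - t)" by (simp add: \<rho>_def algebra_simps)
  qed simp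
  have "integral {0..\<rho>} q + integral {\<rho>..1} q = integral {0..1} q"
    using \<rho> by (intro Henstock_Kurzweil_Integration.integral_combine integrable_continuous_real cont') auto
  with has_integral_combine[OF _ _ 1 2] \<rho> show ?thesis by simp
qed

section \<open>Removing the fractional parts\<close>

lemma lattice_sum_line_minus:
  fixes f :: "real ^ 'n \<Rightarrow> complex"
  assumes "f \<in> C0_infinity" and "S \<subseteq> int_lattice" and "N \<ge> 1"
  shows "((\<lambda>s. lattice_sum S N f (z - s *\<^sub>R w)) has_vector_derivative
      (- 1 / real N) *\<^sub>R lattice_sum S N (dderiv w f) (z - s *\<^sub>R w)) (at s)"
proof -
  have "((\<lambda>s::real. - s) has_vector_derivative - 1) (at s)"
    by (auto intro!: derivative_eq_intros)
  from vector_diff_chain_at[OF this lattice_sum_line[OF assms, of z w "- s"]]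
  show ?thesis by (simp add: o_def)
qed

text \<open>The one-variable expansion along the segment from \<open>z\<close> to
  \<open>z - w\<close>. The constant is chosen before \<open>S\<close>, \<open>N\<close> and
  \<open>z\<close>, so the estimate can later be integrated over \<open>z\<close>.\<close>

lemma lattice_sum_todd:
  fixes f :: "real ^ 'n \<Rightarrow> complex"
  assumes f: "f \<in> C0_infinity"
  obtains K where "K \<ge> 0"
    "\<And>S N z. S \<subseteq> int_lattice \<Longrightarrow> N \<ge> 1 \<Longrightarrow>
      norm (lattice_sum S N f z - (\<Sum>a<M. (todd_coeff a / real N ^ a) *\<^sub>R
         integral {0..1} (\<lambda>s. lattice_sum S N ((dderiv w ^^ a) f) (z - s *\<^sub>R w)))) \<le> K / real N ^ M"
proof -
  obtain C where C: "C \<ge> 0" "\<And>S N z. S \<subseteq> int_lattice \<Longrightarrow> N \<ge> 1 \<Longrightarrow> norm (lattice_sum S N ((dderiv w ^^ M) f) z) \<le> C"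
    using lattice_sum_bounded[OF C0_infinity_dderiv_pow[OF f]] by metis
  define T where "T = 1 + (\<Sum>a<M. \<bar>todd_coeff a\<bar>)"
  show ?thesis
  proof (rule that[of "T * C"])
    show "0 \<le> T * C" using C by (simp add: T_def sum_nonneg)
    fix S :: "(real ^ 'n) set" and N :: nat and z
    assume S: "S \<subseteq> int_lattice" and N: "N \<ge> 1"
    \<comment> \<open>The derivative of order \<open>a\<close> along the segment. Its sign
      \<open>(- 1) ^ a\<close> cancels the one in \<open>todd_expansion_1d\<close>.\<close>
    define q where "q a s = ((- 1) ^ a / real N ^ a) *\<^sub>R lattice_sum S N ((dderiv w ^^ a) f) (z - s *\<^sub>R w)" for a s
    have "norm (q 0 0 - (\<Sum>a<M. ((- 1) ^ a * todd_coeff a) *\<^sub>R integral {0..1} (q a))) \<le> T * (C / real N ^ M)"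
      unfolding T_def
    proof (rule todd_expansion_1d)
      show "(q a has_vector_derivative q (Suc a) x) (at x within {0..1})" for a x
      proof -
        have "((\<lambda>s. ((- 1) ^ a / real N ^ a) *\<^sub>R lattice_sum S N ((dderiv w ^^ a) f) (z - s *\<^sub>R w)) has_vector_derivative
           ((- 1) ^ a / real N ^ a) *\<^sub>R (- 1 / real N) *\<^sub>R lattice_sum S N (dderiv w ((dderiv w ^^ a) f)) (z - x *\<^sub>R w)) (at x within {0..1})"
          by (intro has_vector_derivative_at_within[OF bounded_linear.has_vector_derivative[OF bounded_linear_scaleR_right]]
              lattice_sum_line_minus C0_infinity_dderiv_pow f S N)
        then show ?thesis by (simp add: q_def[abs_def] mult.commute[of "real N"])
      qed
      show "norm (q M x) \<le> C / real N ^ M" for x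
        unfolding q_def using C(2)[OF S N, of "z - x *\<^sub>R w"] by (simp add: abs_mult divide_right_mono power_abs)
    qed
    also have "q 0 0 = lattice_sum S N f z" by (simp add: q_def)
    also have "(\<Sum>a<M. ((- 1) ^ a * todd_coeff a) *\<^sub>R integral {0..1} (q a)) =
       (\<Sum>a<M. (todd_coeff a / real N ^ a) *\<^sub>R integral {0..1} (\<lambda>s. lattice_sum S N ((dderiv w ^^ a) f) (z - s *\<^sub>R w)))"
    proof (rule sum.cong)
      fix a
      have "integral {0..1} (q a) = ((- 1) ^ a / real N ^ a) *\<^sub>R integral {0..1} (\<lambda>s. lattice_sum S N ((dderiv w ^^ a) f) (z - s *\<^sub>R w))"
        unfolding q_def by (rule integral_cmul)
      then show "((- 1) ^ a * todd_coeff a) *\<^sub>R integral {0..1} (q a) =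
          (todd_coeff a / real N ^ a) *\<^sub>R integral {0..1} (\<lambda>s. lattice_sum S N ((dderiv w ^^ a) f) (z - s *\<^sub>R w))"
        by (simp add: mult.commute flip: power_mult_distrib)
    qed simp
    finally show "norm (lattice_sum S N f z - (\<Sum>a<M. (todd_coeff a / real N ^ a) *\<^sub>R
         integral {0..1} (\<lambda>s. lattice_sum S N ((dderiv w ^^ a) f) (z - s *\<^sub>R w)))) \<le> T * C / real N ^ M"
      by simp
  qed
qed

text \<open>In the Todd expansion of \<open>dderiv w f\<close> every term is the average over a full
  period of a derivative of a periodic function, hence 0. Only the error is left.\<close>

lemma lattice_sum_dderiv_period_small:
  fixes f :: "real ^ 'n \<Rightarrow> complex"
  assumes f: "f \<in> C0_infinity"
  obtains K where "K \<ge> 0"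
    "\<And>S N z. S \<subseteq> int_lattice \<Longrightarrow> N \<ge> 1 \<Longrightarrow> (\<And>g z. lattice_sum S N g (z + w) = lattice_sum S N g z) \<Longrightarrow>
      norm (lattice_sum S N (dderiv w f) z) \<le> K / real N ^ M"
proof -
  obtain K where K: "K \<ge> 0" "\<And>S N z. S \<subseteq> int_lattice \<Longrightarrow> N \<ge> 1 \<Longrightarrow>
      norm (lattice_sum S N (dderiv w f) z - (\<Sum>a<M. (todd_coeff a / real N ^ a) *\<^sub>R
         integral {0..1} (\<lambda>s. lattice_sum S N ((dderiv w ^^ a) (dderiv w f)) (z - s *\<^sub>R w)))) \<le> K / real N ^ M"
    using that by (rule lattice_sum_todd[OF C0_infinity_dderiv[OF f]])
  show ?thesis
  proof (rule that[OF K(1)])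
    fix S :: "(real ^ 'n) set" and N :: nat and z
    assume S: "S \<subseteq> int_lattice" and N: "N \<ge> 1" and per: "\<And>g z. lattice_sum S N g (z + w) = lattice_sum S N g z"
    have "integral {0..1} (\<lambda>s. lattice_sum S N ((dderiv w ^^ a) (dderiv w f)) (z - s *\<^sub>R w)) = 0" for a
    proof -
      let ?g = "(dderiv w ^^ a) f"
      have "((\<lambda>s. (- 1 / real N) *\<^sub>R lattice_sum S N (dderiv w ?g) (z - s *\<^sub>R w)) has_integral
          lattice_sum S N ?g (z - 1 *\<^sub>R w) - lattice_sum S N ?g (z - 0 *\<^sub>R w)) {0..1}"
        by (intro fundamental_theorem_of_calculus has_vector_derivative_at_within[OF lattice_sum_line_minus]
              C0_infinity_dderiv_pow f S N) auto
      also have "lattice_sum S N ?g (z - 1 *\<^sub>R w) - lattice_sum S N ?g (z - 0 *\<^sub>R w) = 0"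
        using per[of ?g "z - w"] by simp
      finally have "((\<lambda>s. (- 1 / real N) *\<^sub>R lattice_sum S N (dderiv w ?g) (z - s *\<^sub>R w)) has_integral 0) {0..1}" .
      from has_integral_cmul[OF this, of "- real N"]
      have "((\<lambda>s. lattice_sum S N (dderiv w ?g) (z - s *\<^sub>R w)) has_integral 0) {0..1}"
        using N by simp
      then show ?thesis by (simp add: funpow_swap1 integral_unique)
    qed
    with K(2)[OF S N, of z] show "norm (lattice_sum S N (dderiv w f) z) \<le> K / real N ^ M"
      by simp
  qed
qed

text \<open>The mean value inequality along \<open>w\<close>, whose derivative is small by
  \<open>lattice_sum_dderiv_period_small\<close>.\<close>

lemma lattice_sum_period_translate_small:
  fixes f :: "real ^ 'n \<Rightarrow> complex"
  assumes f: "f \<in> C0_infinity"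
  obtains K where "K \<ge> 0"
    "\<And>S N z s. S \<subseteq> int_lattice \<Longrightarrow> N \<ge> 1 \<Longrightarrow> (\<And>g z. lattice_sum S N g (z + w) = lattice_sum S N g z) \<Longrightarrow>
      norm (lattice_sum S N f (z + s *\<^sub>R w) - lattice_sum S N f z) \<le> \<bar>s\<bar> * (K / real N ^ M)"
proof -
  obtain K where K: "K \<ge> 0"
    "\<And>S N z. S \<subseteq> int_lattice \<Longrightarrow> N \<ge> 1 \<Longrightarrow> (\<And>g z. lattice_sum S N g (z + w) = lattice_sum S N g z) \<Longrightarrow>
      norm (lattice_sum S N (dderiv w f) z) \<le> K / real N ^ M"
    using lattice_sum_dderiv_period_small[OF f, where w=w and M=M] by blast
  show ?thesis
  proof (rule that[OF K(1)])
    fix S :: "(real ^ 'n) set" and N :: nat and z and s :: real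
    assume S: "S \<subseteq> int_lattice" and N: "N \<ge> 1" and per: "\<And>g z. lattice_sum S N g (z + w) = lattice_sum S N g z"
    let ?g = "\<lambda>s. lattice_sum S N f (z + s *\<^sub>R w)"
    have "norm (?g s - ?g 0) \<le> (K / real N ^ M) * norm (s - 0)"
    proof (rule differentiable_bound[where S=UNIV])
      fix x
      show "(?g has_derivative (\<lambda>t. t *\<^sub>R ((1 / real N) *\<^sub>R lattice_sum S N (dderiv w f) (z + x *\<^sub>R w)))) (at x)"
        using lattice_sum_line[OF f S N] by (simp only: has_vector_derivative_def)
      show "onorm (\<lambda>t. t *\<^sub>R ((1 / real N) *\<^sub>R lattice_sum S N (dderiv w f) (z + x *\<^sub>R w))) \<le> K / real N ^ M"
      proof (rule onorm_bound)
        show "0 \<le> K / real N ^ M" using K by simp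
        fix t :: real
        \<comment> \<open>The extra factor \<open>1 / N\<close> from differentiation is
          discarded.\<close>
        have "norm ((1 / real N) *\<^sub>R lattice_sum S N (dderiv w f) (z + x *\<^sub>R w)) \<le> norm (lattice_sum S N (dderiv w f) (z + x *\<^sub>R w))"
          using N by (simp add: divide_le_eq mult_le_cancel_left1)
        also have "\<dots> \<le> K / real N ^ M" by (rule K(2)[OF S N per])
        finally show "norm (t *\<^sub>R ((1 / real N) *\<^sub>R lattice_sum S N (dderiv w f) (z + x *\<^sub>R w))) \<le> K / real N ^ M * norm t"
          by (simp only: norm_scaleR real_norm_def mult.commute[of "\<bar>t\<bar>"] mult_right_mono abs_ge_zero)
      qed
    qed auto
    then show "norm (lattice_sum S N f (z + s *\<^sub>R w) - lattice_sum S N f z) \<le> \<bar>s\<bar> * (K / real N ^ M)"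
      by (simp add: mult.commute)
  qed
qed

text \<open>From here on regularity enters only through the dual lattice vectors
  \<open>v\<close>.\<close>

locale dual_system =
  fixes u v :: "nat \<Rightarrow> real ^ 'n" and c :: "nat \<Rightarrow> int" and m :: nat
  assumes u_lattice: "i < m \<Longrightarrow> u i \<in> int_lattice"
    and v_lattice: "i < m \<Longrightarrow> v i \<in> int_lattice"
    and dual: "i < m \<Longrightarrow> j < m \<Longrightarrow> u i \<bullet> v j = (if i = j then 1 else 0)"
begin

definition W :: "(real ^ 'n) set" where
  "W = halfspaces_Int m u (\<lambda>i. of_int (c i))"

definition S :: "nat \<Rightarrow> (real ^ 'n) set" where
  "S N = int_lattice \<inter> (\<lambda>x. real N *\<^sub>R x) ` W"

text \<open>The projection \<open>P\<close> along the \<open>v i\<close>. Because the pairings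
  \<open>u i \<bullet> x\<close> are integers at lattice points, it maps the lattice to
  itself.\<close>

definition proj :: "real ^ 'n \<Rightarrow> real ^ 'n" where
  "proj x = x - (\<Sum>i<m. (u i \<bullet> x) *\<^sub>R v i)"

definition rho :: "nat \<Rightarrow> real ^ 'n \<Rightarrow> real" where
  "rho i y = of_int \<lceil>u i \<bullet> y\<rceil> - u i \<bullet> y"

text \<open>Interpolates between the cell average and the lattice sum: \<open>bpt 0 y\<close> is congruent
  to \<open>y\<close> modulo the lattice, while \<open>bpt m y\<close> lies in the common kernel of the \<open>u i\<close>.\<close>

definition bpt :: "nat \<Rightarrow> real ^ 'n \<Rightarrow> real ^ 'n" where
  "bpt j y = proj y - (\<Sum>i\<in>{j..<m}. rho i y *\<^sub>R v i)"

text \<open>At \<open>j = 0\<close> this is the integral over \<open>W\<close>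
  (\<open>cell_avg_0\<close>); at \<open>j = m\<close> it is the lattice sum at 0 up to any power of
  \<open>1 / N\<close> (\<open>cell_avg_m\<close>).\<close>

definition cell_avg :: "nat \<Rightarrow> nat \<Rightarrow> (real ^ 'n \<Rightarrow> complex) \<Rightarrow> complex" where
  "cell_avg j N f = (LINT y:unit_cube|lborel. lattice_sum (S N) N f (bpt j y))"

lemma S_sub: "S N \<subseteq> int_lattice" by (simp add: S_def)

lemma scaled_W_iff: "N \<ge> 1 \<Longrightarrow> (x /\<^sub>R real N \<in> W) \<longleftrightarrow> (\<forall>i<m. u i \<bullet> x \<le> real N * of_int (c i))"
  by (simp add: W_def halfspaces_Int_def field_simps)

lemma S_iff: "N \<ge> 1 \<Longrightarrow> k \<in> S N \<longleftrightarrow> k \<in> int_lattice \<and> (\<forall>i<m. u i \<bullet> k \<le> real N * of_int (c i))"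
proof -
  assume N: "N \<ge> 1"
  have "k \<in> (\<lambda>x. real N *\<^sub>R x) ` W \<longleftrightarrow> k /\<^sub>R real N \<in> W"
  proof
    assume "k /\<^sub>R real N \<in> W"
    then show "k \<in> (\<lambda>x. real N *\<^sub>R x) ` W" using N by (intro image_eqI[of _ _ "k /\<^sub>R real N"]) auto
  qed (use N in auto)
  then show ?thesis using scaled_W_iff[OF N] by (simp add: S_def)
qed

lemma inner_sum_v: "i < m \<Longrightarrow> J \<subseteq> {..<m} \<Longrightarrow> u i \<bullet> (\<Sum>j\<in>J. a j *\<^sub>R v j) = (if i \<in> J then a i else 0)"
proof -
  assume i: "i < m" and J: "J \<subseteq> {..<m}"
  have "u i \<bullet> (\<Sum>j\<in>J. a j *\<^sub>R v j) = (\<Sum>j\<in>J. if j = i then a i else 0)"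
    unfolding inner_sum_right using i J by (intro sum.cong) (auto simp: dual)
  then show ?thesis using finite_subset[OF J] by simp
qed

lemma inner_proj: "i < m \<Longrightarrow> u i \<bullet> proj x = 0"
  by (simp add: proj_def inner_diff_right inner_sum_v)

lemma linear_proj: "linear proj"
  unfolding proj_def
  by (rule linearI) (simp_all add: inner_add_right scaleR_add_left sum.distrib scaleR_sum_right algebra_simps)

lemma proj_add: "proj (x + y) = proj x + proj y"
  by (rule linear_add[OF linear_proj])

lemma proj_lattice: "k \<in> int_lattice \<Longrightarrow> proj k \<in> int_lattice"
  unfolding proj_def
  by (intro int_lattice_diff int_lattice_sum int_lattice_scaleR int_lattice_inner u_lattice v_lattice) auto

lemma proj_v: "j < m \<Longrightarrow> proj (t *\<^sub>R v j) = 0"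
proof -
  assume j: "j < m"
  have "(\<Sum>i<m. (u i \<bullet> (t *\<^sub>R v j)) *\<^sub>R v i) = (\<Sum>i<m. if i = j then t *\<^sub>R v j else 0)"
    using j by (intro sum.cong) (auto simp: dual)
  then show ?thesis using j by (simp add: proj_def)
qed

text \<open>All \<open>u i\<close> vanish on \<open>proj l\<close>, so translation by this lattice
  vector preserves \<open>S N\<close>.\<close>

lemma S_periodic:
  assumes "N \<ge> 1" "l \<in> int_lattice"
  shows "lattice_sum (S N) N f (z + proj l) = lattice_sum (S N) N f z"
  by (rule lattice_sum_periodic)
    (use assms in \<open>auto simp: S_iff inner_add_right inner_diff_right inner_proj int_lattice_add int_lattice_diff proj_lattice\<close>)

lemma bpt_0: "bpt 0 y = y - (\<Sum>i<m. of_int \<lceil>u i \<bullet> y\<rceil> *\<^sub>R v i)"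
  unfolding bpt_def proj_def rho_def atLeast0LessThan
  by (simp add: scaleR_diff_left sum_subtractf)

lemma bpt_Suc: "j < m \<Longrightarrow> bpt j y = bpt (Suc j) y - rho j y *\<^sub>R v j"
  unfolding bpt_def by (simp add: sum.atLeast_Suc_lessThan algebra_simps)

lemma bpt_m: "bpt m y = proj y"
  by (simp add: bpt_def)

lemma bpt_borel [measurable]: "bpt j \<in> borel_measurable borel"
proof -
  have [measurable]: "proj \<in> borel_measurable borel"
    by (intro borel_measurable_continuous_onI linear_continuous_on linear_conv_bounded_linear[THEN iffD1] linear_proj)
  show ?thesis unfolding bpt_def[abs_def] rho_def by measurable
qed

lemma rho_lattice_shift: "i < m \<Longrightarrow> l \<in> int_lattice \<Longrightarrow> rho i (y + l) = rho i y"
proof -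
  assume "i < m" "l \<in> int_lattice"
  from int_lattice_inner[OF u_lattice[OF this(1)] this(2)] \<open>i < m\<close> obtain n :: int where "u i \<bullet> l = of_int n"
    by (auto elim: Ints_cases)
  then show ?thesis by (simp add: rho_def inner_add_right)
qed

lemma bpt_lattice_shift: "l \<in> int_lattice \<Longrightarrow> bpt j (y + l) = bpt j y + proj l"
  unfolding bpt_def by (simp add: proj_add rho_lattice_shift)

text \<open>Neither \<open>proj\<close> nor the pairings with \<open>u i\<close> for
  \<open>i \<noteq> j\<close> notice a move along \<open>v j\<close>, and \<open>rho j\<close> does
  not occur in \<open>bpt (Suc j)\<close>.\<close>

lemma bpt_Suc_shift: "j < m \<Longrightarrow> bpt (Suc j) (y + t *\<^sub>R v j) = bpt (Suc j) y"
  unfolding bpt_def by (simp add: proj_add proj_v rho_def inner_add_right dual)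

text \<open>Translation by \<open>t *\<^sub>R v j\<close> turns \<open>rho j\<close> into its fractional shift by \<open>t\<close> and leaves
  \<open>bpt (Suc j)\<close> alone, so averaging over \<open>t \<in> [0, 1]\<close> makes it uniform.\<close>

lemma rho_average:
  fixes g :: "real ^ 'n \<Rightarrow> complex"
  assumes j: "j < m" and cont: "continuous_on UNIV g" and bd: "\<And>z. norm (g z) \<le> B"
    and per: "\<And>z l. l \<in> int_lattice \<Longrightarrow> g (z + proj l) = g z"
  shows "(LINT y:unit_cube|lborel. g (bpt j y)) =
     (LINT y:unit_cube|lborel. integral {0..1} (\<lambda>s. g (bpt (Suc j) y - s *\<^sub>R v j)))"
proof -
  have [measurable]: "g \<in> borel_measurable borel" using cont by (rule borel_measurable_continuous_onI)
  define H where "H y = g (bpt j y)" for y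
  have H_meas [measurable]: "H \<in> borel_measurable borel" unfolding H_def by measurable
  have H_per: "H (y + l) = H y" if "l \<in> int_lattice" for y l
    using that by (simp add: H_def bpt_lattice_shift per)
  \<comment> \<open>\<open>H\<close> is periodic under the lattice because \<open>bpt j\<close>
    changes by a vector \<open>proj l\<close>, a period of \<open>g\<close>.\<close>
  have trans: "(LINT y:unit_cube|lborel. H (y + t *\<^sub>R v j)) = (LINT y:unit_cube|lborel. H y)" for t
    by (rule integral_unit_cube_translate[where B=B]) (use bd H_per in \<open>auto simp: H_def\<close>)
  have inner: "(LINT t:{0..1}|lborel. H (y + t *\<^sub>R v j)) = integral {0..1} (\<lambda>s. g (bpt (Suc j) y - s *\<^sub>R v j))" for y
  proof -
    have "set_integrable lborel {0..1} (\<lambda>t. H (y + t *\<^sub>R v j))"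
      unfolding set_integrable_def
      by (rule integrableI_bounded_set_indicator[of _ _ _ B]) (use bd in \<open>auto simp: H_def\<close>)
    then have "(LINT t:{0..1}|lborel. H (y + t *\<^sub>R v j)) = integral {0..1} (\<lambda>t. H (y + t *\<^sub>R v j))"
      by (rule set_borel_integral_eq_integral)
    also have "\<dots> = integral {0..1} (\<lambda>t. g (bpt (Suc j) y - (of_int \<lceil>u j \<bullet> y + t\<rceil> - (u j \<bullet> y + t)) *\<^sub>R v j))"
      using j by (simp add: H_def bpt_Suc bpt_Suc_shift rho_def inner_add_right dual)
    also have "\<dots> = integral {0..1} (\<lambda>s. g (bpt (Suc j) y - s *\<^sub>R v j))"
      by (rule integral_unique[OF integral_frac_shift])
         (intro continuous_on_compose2[OF cont] continuous_intros, auto)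
    finally show ?thesis .
  qed
  have int2: "integrable (lborel \<Otimes>\<^sub>M lborel)
     (\<lambda>(y, t). (indicat_real unit_cube y * indicat_real {0..1::real} t) *\<^sub>R H (y + t *\<^sub>R v j))"
  proof -
    have "emeasure (lborel \<Otimes>\<^sub>M lborel) ((unit_cube :: (real ^ 'n) set) \<times> {0..1::real}) < \<infinity>"
      using finite_emeasure_unit_cube[where 'n='n]
      by (subst lborel.emeasure_pair_measure_Times) auto
    then have "integrable (lborel \<Otimes>\<^sub>M lborel)
       (\<lambda>p. indicat_real ((unit_cube :: (real ^ 'n) set) \<times> {0..1::real}) p *\<^sub>R H (fst p + snd p *\<^sub>R v j))"
      by (intro integrableI_bounded_set_indicator[of _ _ _ B]) (use bd in \<open>auto simp: H_def\<close>)
    then show ?thesis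
      by (rule Bochner_Integration.integrable_cong[THEN iffD1, rotated 2]) (auto simp: indicator_def)
  qed
  \<comment> \<open>Each translate has the same integral, so averaging over \<open>t\<close> costs
    nothing; then the order of integration is exchanged.\<close>
  have "(LINT y:unit_cube|lborel. H y) = (LINT t:{0..1::real}|lborel. (LINT y:unit_cube|lborel. H (y + t *\<^sub>R v j)))"
    unfolding trans by (simp add: set_lebesgue_integral_def)
  also have "\<dots> = (LINT t|lborel. LINT y|lborel. (indicat_real unit_cube y * indicat_real {0..1::real} t) *\<^sub>R H (y + t *\<^sub>R v j))"
    unfolding set_lebesgue_integral_def
    by (simp add: mult.commute flip: integral_scaleR_right)
  also have "\<dots> = (LINT y|lborel. LINT t|lborel. (indicat_real unit_cube y * indicat_real {0..1::real} t) *\<^sub>R H (y + t *\<^sub>R v j))"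
    by (rule lborel_pair.Fubini_integral[OF int2])
  also have "\<dots> = (LINT y:unit_cube|lborel. LINT t:{0..1}|lborel. H (y + t *\<^sub>R v j))"
    unfolding set_lebesgue_integral_def
    by (simp flip: scaleR_scaleR)
  finally show ?thesis unfolding inner by (simp add: H_def)
qed

end

section \<open>Scaling, integrability and bounds for the integrals involved\<close>

lemma closed_halfspaces_Int: "closed (halfspaces_Int m u b)"
proof -
  have "halfspaces_Int m u b = (\<Inter>i\<in>{..<m}. {x. u i \<bullet> x \<le> b i})"
    by (auto simp: halfspaces_Int_def)
  also have "closed \<dots>" by (intro closed_INT ballI closed_halfspace_le)
  finally show ?thesis .
qed

lemma lborel_integral_scale:
  fixes g :: "'a::euclidean_space \<Rightarrow> 'b::{banach,second_countable_topology}"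
  assumes [measurable]: "g \<in> borel_measurable borel" and N: "N > 0"
  shows "(LINT x|lborel. g x) = (1 / N ^ DIM('a)) *\<^sub>R (LINT x|lborel. g (x /\<^sub>R N))"
proof -
  have "(LINT x|lborel. g x) = (LINT x|density (distr lborel borel (\<lambda>x. 0 + inverse N *\<^sub>R x)) (\<lambda>_. ennreal (\<bar>inverse N\<bar> ^ DIM('a))). g x)"
    using N by (subst lborel_affine[of "inverse N" 0]) (auto simp: prod_constant)
  also have "\<dots> = (LINT x|distr lborel borel (\<lambda>x. 0 + inverse N *\<^sub>R x). \<bar>inverse N\<bar> ^ DIM('a) *\<^sub>R g x)"
    by (rule integral_density) auto
  also have "\<dots> = (LINT x|lborel. \<bar>inverse N\<bar> ^ DIM('a) *\<^sub>R g (0 + inverse N *\<^sub>R x))"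
    by (rule integral_distr) auto
  finally show ?thesis using N by (simp add: inverse_eq_divide power_one_over)
qed

lemma C0_infinity_borel: "f \<in> C0_infinity \<Longrightarrow> f \<in> borel_measurable borel"
  by (rule borel_measurable_continuous_onI[OF C0_infinity_continuous])

lemma integrable_bounded_support:
  fixes f :: "'a::euclidean_space \<Rightarrow> complex"
  assumes [measurable]: "f \<in> borel_measurable borel"
    and bd: "\<And>x. norm (f x) \<le> B" and supp: "\<And>x. f x \<noteq> 0 \<Longrightarrow> norm x \<le> r"
  shows "integrable lborel f"
proof -
  have "integrable lborel (\<lambda>x. indicat_real (cball 0 r) x *\<^sub>R f x)"
    by (rule integrableI_bounded_set_indicator[of _ _ _ B])
       (use bd emeasure_bounded_finite[OF bounded_cball, of 0 r] in auto)
  also have "(\<lambda>x. indicat_real (cball 0 r) x *\<^sub>R f x) = f"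
    using supp by (auto simp: fun_eq_iff indicator_def)
  finally show ?thesis .
qed

lemma continuous_segment_average:
  fixes g :: "'a::euclidean_space \<Rightarrow> complex"
  assumes "continuous_on UNIV g"
  shows "continuous_on UNIV (\<lambda>z. integral {0..1} (\<lambda>s. g (z - s *\<^sub>R w)))"
proof -
  have "continuous_on UNIV (\<lambda>z. integral (cbox 0 1) (\<lambda>s. g (z - s *\<^sub>R w)))"
  proof (rule integral_continuous_on_param)
    show "continuous_on (UNIV \<times> cbox 0 1) (\<lambda>(z, s). g (z - s *\<^sub>R w))"
      unfolding case_prod_unfold
      by (intro continuous_on_compose2[OF assms] continuous_intros) auto
  qed
  then show ?thesis by (simp add: cbox_interval)
qed

lemma norm_segment_average:
  fixes g :: "'a::euclidean_space \<Rightarrow> complex"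
  assumes cont: "continuous_on UNIV g" and bd: "\<And>z. norm (g z) \<le> B"
  shows "norm (integral {0..1} (\<lambda>s. g (z - s *\<^sub>R w))) \<le> B"
proof -
  have "B \<ge> 0" using order_trans[OF norm_ge_zero bd] .
  moreover have "((\<lambda>s. g (z - s *\<^sub>R w)) has_integral integral {0..1} (\<lambda>s. g (z - s *\<^sub>R w))) {0..1}"
    by (intro integrable_integral integrable_continuous_real continuous_on_compose2[OF cont] continuous_intros) auto
  ultimately show ?thesis
    using has_integral_bound_real[of B "{}" _ _ 0 1] bd by fastforce
qed

lemma norm_unit_cube_integral:
  fixes H :: "real ^ 'n \<Rightarrow> complex"
  assumes [measurable]: "H \<in> borel_measurable borel"
    and bd: "\<And>y. y \<in> unit_cube \<Longrightarrow> norm (H y) \<le> B" and B: "B \<ge> 0"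
  shows "norm (LINT y:unit_cube|lborel. H y) \<le> B"
proof -
  have ic: "integrable lborel (\<lambda>y. indicat_real (unit_cube :: (real ^ 'n) set) y * B)"
    using integrableI_bounded_set_indicator[of "unit_cube :: (real ^ 'n) set" lborel "\<lambda>_. B" B] finite_emeasure_unit_cube[where 'n='n] B
    by simp
  have "norm (LINT y:unit_cube|lborel. H y) \<le> (LINT y|lborel. norm (indicat_real unit_cube y *\<^sub>R H y))"
    unfolding set_lebesgue_integral_def by (rule integral_norm_bound)
  also have "\<dots> \<le> (LINT y|lborel. indicat_real (unit_cube :: (real ^ 'n) set) y * B)"
    by (rule integral_mono_AE'[OF ic]) (use bd B in \<open>auto simp: indicator_def\<close>)
  also have "\<dots> = B"
    using measure_unit_cube[where 'n='n] by simp
  finally show ?thesis .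
qed

lemma set_integral_diff_sum:
  fixes F :: "'a \<Rightarrow> 'b::{banach,second_countable_topology}"
  assumes F: "set_integrable M A F" and G: "\<And>a. set_integrable M A (G a)"
  shows "(LINT x:A|M. F x - (\<Sum>a\<in>I. k a *\<^sub>R G a x)) = (LINT x:A|M. F x) - (\<Sum>a\<in>I. k a *\<^sub>R (LINT x:A|M. G a x))"
proof -
  have "(LINT x:A|M. F x - (\<Sum>a\<in>I. k a *\<^sub>R G a x)) =
      (LINT x|M. indicat_real A x *\<^sub>R F x - (\<Sum>a\<in>I. k a *\<^sub>R (indicat_real A x *\<^sub>R G a x)))"
    unfolding set_lebesgue_integral_def
    by (simp add: scaleR_diff_right scaleR_sum_right mult.commute)
  also have "\<dots> = (LINT x:A|M. F x) - (\<Sum>a\<in>I. k a *\<^sub>R (LINT x:A|M. G a x))"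
    using F G unfolding set_lebesgue_integral_def set_integrable_def
    by (simp only: Bochner_Integration.integral_diff Bochner_Integration.integral_sum
        Bochner_Integration.integrable_sum integrable_scaleR_right integral_scaleR_right)
  finally show ?thesis .
qed

section \<open>Cell averages: the two ends and the step between them\<close>

context dual_system
begin

text \<open>Scale by \<open>N\<close> and periodise: the integral becomes an average over
  \<open>y\<close> of sums over those lattice points \<open>k\<close> with \<open>k + y\<close> in
  \<open>N W\<close>. Shifting \<open>k\<close> by a suitable lattice vector turns this condition
  into membership in \<open>S N\<close>, whatever \<open>y\<close> is.\<close>

lemma cell_avg_0:
  assumes f: "f \<in> C0_infinity" and N: "N \<ge> 1"
  shows "cell_avg 0 N f = (LINT x:W|lborel. f x)"
proof -
  have [measurable]: "W \<in> sets borel" by (simp add: W_def borel_closed closed_halfspaces_Int)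
  have [measurable]: "f \<in> borel_measurable borel" using f by (rule C0_infinity_borel)
  obtain r where r: "r > 0" "\<And>x. f x \<noteq> 0 \<Longrightarrow> norm x \<le> r" using C0_infinity_support[OF f] by metis
  obtain B where B: "B \<ge> 0" "\<And>x. norm (f x) \<le> B" using C0_infinity_bounded[OF f] by metis
  define H where "H x = (indicat_real W (x /\<^sub>R real N) *\<^sub>R f (x /\<^sub>R real N)) / of_nat N ^ CARD('n)" for x
  have [measurable]: "H \<in> borel_measurable borel" unfolding H_def by measurable
  have H_supp: "norm x \<le> real N * r" if "H x \<noteq> 0" for x
  proof -
    have "f (x /\<^sub>R real N) \<noteq> 0" using that by (auto simp: H_def)
    from r(2)[OF this] have "norm x / real N \<le> r"
      by (simp only: norm_scaleR abs_inverse abs_of_nat divide_inverse_commute)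
    then show ?thesis using N by (simp add: field_simps)
  qed
  have "norm (H x) \<le> B" for x
  proof -
    have "norm (H x) \<le> norm (f (x /\<^sub>R real N)) / real N ^ CARD('n)"
      by (auto simp: H_def norm_divide norm_power indicator_def)
    also have "\<dots> \<le> norm (f (x /\<^sub>R real N))"
      using N by (simp add: divide_le_eq mult_le_cancel_left1 one_le_power)
    finally show ?thesis using B order_trans by blast
  qed
  then have int: "integrable lborel H"
    by (intro integrable_bounded_support[where B=B and r="real N * r"] H_supp) auto
  have "(LINT x:W|lborel. f x) = (1 / real N ^ CARD('n)) *\<^sub>R (LINT x|lborel. indicat_real W (x /\<^sub>R real N) *\<^sub>R f (x /\<^sub>R real N))"
    unfolding set_lebesgue_integral_def
    using N by (subst lborel_integral_scale[of _ "real N"]) auto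
  also have "\<dots> = (LINT x|lborel. H x)"
    unfolding H_def by (simp add: scaleR_conv_of_real divide_inverse mult.commute)
  also have "\<dots> = (LINT y:unit_cube|lborel. (\<Sum>\<^sub>\<infinity>k\<in>int_lattice. H (k + y)))"
    by (rule integral_periodization[OF int H_supp])
  also have "(\<lambda>y. \<Sum>\<^sub>\<infinity>k\<in>int_lattice. H (k + y)) = (\<lambda>y. lattice_sum (S N) N f (bpt 0 y))"
  proof
    fix y
    \<comment> \<open>The lattice vector \<open>y - bpt 0 y\<close>.\<close>
    define l where "l = (\<Sum>i<m. of_int \<lceil>u i \<bullet> y\<rceil> *\<^sub>R v i)"
    have l: "l \<in> int_lattice"
      unfolding l_def by (intro int_lattice_sum int_lattice_scaleR v_lattice) auto
    have ul: "u i \<bullet> l = of_int \<lceil>u i \<bullet> y\<rceil>" if "i < m" for i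
      using that by (simp add: l_def inner_sum_v)
    \<comment> \<open>With integers \<open>n\<close>, \<open>b\<close> and real \<open>x\<close>,
      \<open>n - \<lceil>x\<rceil> + x \<le> b\<close> is equivalent to \<open>n \<le> b\<close>;
      here \<open>x\<close> is \<open>u i \<bullet> y\<close>.\<close>
    have W_iff: "(k - l + y) /\<^sub>R real N \<in> W \<longleftrightarrow> k \<in> S N" if k: "k \<in> int_lattice" for k
    proof -
      have "u i \<bullet> (k - l + y) \<le> real N * of_int (c i) \<longleftrightarrow> u i \<bullet> k \<le> real N * of_int (c i)" if i: "i < m" for i
      proof -
        obtain n :: int where n: "u i \<bullet> k = of_int n"
          using int_lattice_inner[OF u_lattice[OF i] k] by (auto elim: Ints_cases)
        have "u i \<bullet> (k - l + y) \<le> real N * of_int (c i) \<longleftrightarrow>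
            u i \<bullet> y \<le> of_int (int N * c i - n + \<lceil>u i \<bullet> y\<rceil>)"
          by (simp add: inner_add_right inner_diff_right ul[OF i] n algebra_simps)
        also have "\<dots> \<longleftrightarrow> n \<le> int N * c i"
          unfolding ceiling_le_iff[symmetric] by auto
        also have "\<dots> \<longleftrightarrow> u i \<bullet> k \<le> real N * of_int (c i)"
          unfolding n by (metis of_int_le_iff of_int_mult of_int_of_nat_eq)
        finally show ?thesis .
      qed
      then show ?thesis using k by (simp add: scaled_W_iff[OF N] S_iff[OF N])
    qed
    have bij: "bij_betw (\<lambda>k. k - l) int_lattice int_lattice"
      by (rule bij_betw_byWitness[where f'="\<lambda>k. k + l"]) (use l in \<open>auto intro: int_lattice_add int_lattice_diff\<close>)
    have "(\<Sum>\<^sub>\<infinity>k\<in>int_lattice. H (k + y)) = (\<Sum>\<^sub>\<infinity>k\<in>int_lattice. H (k - l + y))"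
      using infsum_reindex_bij_betw[OF bij, of "\<lambda>k. H (k + y)"] by simp
    also have "\<dots> = (\<Sum>\<^sub>\<infinity>k\<in>S N. f ((k + (y - l)) /\<^sub>R real N) / of_nat N ^ CARD('n))"
    proof (rule infsum_cong_neutral)
      fix k assume "k \<in> int_lattice - S N"
      then show "H (k - l + y) = 0" using W_iff[of k] by (simp add: H_def)
    next
      fix k assume "k \<in> int_lattice \<inter> S N"
      then show "H (k - l + y) = f ((k + (y - l)) /\<^sub>R real N) / of_nat N ^ CARD('n)"
        using W_iff[of k] by (simp add: H_def algebra_simps)
    qed (use S_sub in auto)
    also have "\<dots> = lattice_sum (S N) N f (y - l)"
      unfolding lattice_sum_def divide_inverse by (rule infsum_cmult_left')
    finally show "(\<Sum>\<^sub>\<infinity>k\<in>int_lattice. H (k + y)) = lattice_sum (S N) N f (bpt 0 y)"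
      by (simp add: bpt_0 l_def)
  qed
  finally show ?thesis by (simp add: cell_avg_def)
qed

lemma lattice_sum_bpt_borel:
  assumes "f \<in> C0_infinity" "N \<ge> 1"
  shows "(\<lambda>y. lattice_sum (S N) N f (bpt j y)) \<in> borel_measurable borel"
proof -
  have [measurable]: "lattice_sum (S N) N f \<in> borel_measurable borel"
    by (intro borel_measurable_continuous_onI continuous_lattice_sum S_sub assms)
  show ?thesis by measurable
qed

lemma cell_avg_bounded:
  assumes f: "f \<in> C0_infinity"
  obtains K where "K \<ge> 0" "\<And>N. N \<ge> 1 \<Longrightarrow> norm (cell_avg j N f) \<le> K"
proof -
  obtain C where C: "C \<ge> 0" "\<And>S N z. S \<subseteq> int_lattice \<Longrightarrow> N \<ge> 1 \<Longrightarrow> norm (lattice_sum S N f z) \<le> C"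
    using lattice_sum_bounded[OF f] by metis
  show ?thesis
  proof (rule that[OF C(1)])
    fix N :: nat assume "N \<ge> 1"
    then show "norm (cell_avg j N f) \<le> C"
      unfolding cell_avg_def by (intro norm_unit_cube_integral lattice_sum_bpt_borel f C S_sub)
  qed
qed

text \<open>Integrate the pointwise estimate \<open>lattice_sum_todd\<close> at
  \<open>z = bpt (Suc j) y\<close> over the cube. By \<open>rho_average\<close> the integrated
  segment averages are the cell averages of index \<open>j\<close>.\<close>

lemma cell_avg_step:
  assumes f: "f \<in> C0_infinity" and j: "j < m"
  obtains K where "K \<ge> 0" "\<And>N. N \<ge> 1 \<Longrightarrow>
    norm (cell_avg (Suc j) N f - (\<Sum>a<M. (todd_coeff a / real N ^ a) *\<^sub>R cell_avg j N ((dderiv (v j) ^^ a) f))) \<le> K / real N ^ M"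
proof -
  obtain K where K: "K \<ge> 0"
    "\<And>S N z. S \<subseteq> int_lattice \<Longrightarrow> N \<ge> 1 \<Longrightarrow>
      norm (lattice_sum S N f z - (\<Sum>a<M. (todd_coeff a / real N ^ a) *\<^sub>R
         integral {0..1} (\<lambda>s. lattice_sum S N ((dderiv (v j) ^^ a) f) (z - s *\<^sub>R v j)))) \<le> K / real N ^ M"
    using that by (rule lattice_sum_todd[OF f])
  show ?thesis
  proof (rule that[OF K(1)])
    fix N :: nat assume N: "N \<ge> 1"
    let ?g = "\<lambda>a. lattice_sum (S N) N ((dderiv (v j) ^^ a) f)"
    let ?G = "\<lambda>a y. integral {0..1} (\<lambda>s. ?g a (bpt (Suc j) y - s *\<^sub>R v j))"
    have g_cont: "continuous_on UNIV (?g a)" for a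
      by (intro continuous_lattice_sum C0_infinity_dderiv_pow f N S_sub)
    have G_meas [measurable]: "?G a \<in> borel_measurable borel" for a
      using measurable_compose[OF bpt_borel borel_measurable_continuous_onI[OF continuous_segment_average[OF g_cont]]]
      by simp
    have f_meas [measurable]: "(\<lambda>y. lattice_sum (S N) N f (bpt (Suc j) y)) \<in> borel_measurable borel"
      by (rule lattice_sum_bpt_borel[OF f N])
    have avg: "cell_avg j N ((dderiv (v j) ^^ a) f) = (LINT y:unit_cube|lborel. ?G a y)"
      and G_int: "set_integrable lborel unit_cube (?G a)" for a
    proof -
      obtain C where C: "\<And>z. norm (?g a z) \<le> C"
        using lattice_sum_bounded[OF C0_infinity_dderiv_pow[OF f]] S_sub N by metis
      show "cell_avg j N ((dderiv (v j) ^^ a) f) = (LINT y:unit_cube|lborel. ?G a y)"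
        unfolding cell_avg_def by (rule rho_average[OF j g_cont C S_periodic[OF N]])
      show "set_integrable lborel unit_cube (?G a)"
        by (rule set_integrable_unit_cube[OF G_meas]) (rule norm_segment_average[OF g_cont C])
    qed
    have f_int: "set_integrable lborel unit_cube (\<lambda>y. lattice_sum (S N) N f (bpt (Suc j) y))"
    proof -
      obtain C where C: "\<And>z. norm (lattice_sum (S N) N f z) \<le> C"
        using lattice_sum_bounded[OF f] S_sub N by metis
      show ?thesis by (rule set_integrable_unit_cube[OF f_meas C])
    qed
    have "(LINT y:unit_cube|lborel. lattice_sum (S N) N f (bpt (Suc j) y) - (\<Sum>a<M. (todd_coeff a / real N ^ a) *\<^sub>R ?G a y))
      = cell_avg (Suc j) N f - (\<Sum>a<M. (todd_coeff a / real N ^ a) *\<^sub>R cell_avg j N ((dderiv (v j) ^^ a) f))"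
      unfolding avg unfolding cell_avg_def by (rule set_integral_diff_sum[OF f_int G_int])
    moreover have "norm (LINT y:unit_cube|lborel. lattice_sum (S N) N f (bpt (Suc j) y) - (\<Sum>a<M. (todd_coeff a / real N ^ a) *\<^sub>R ?G a y)) \<le> K / real N ^ M"
      by (intro norm_unit_cube_integral K S_sub N) (use K(1) in auto)
    ultimately show "norm (cell_avg (Suc j) N f - (\<Sum>a<M. (todd_coeff a / real N ^ a) *\<^sub>R cell_avg j N ((dderiv (v j) ^^ a) f))) \<le> K / real N ^ M"
      by simp
  qed
qed

text \<open>One coordinate is moved at a time. Each \<open>proj (axis j 1)\<close> is a period by
  \<open>S_periodic\<close>, and the coordinates of \<open>y\<close> are at most 1.\<close>

lemma lattice_sum_proj_small:
  assumes f: "f \<in> C0_infinity" and F: "finite F"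
  shows "\<exists>K\<ge>0. \<forall>N y. N \<ge> 1 \<longrightarrow> y \<in> unit_cube \<longrightarrow>
     norm (lattice_sum (S N) N f (\<Sum>j\<in>F. (y $ j) *\<^sub>R proj (axis j 1)) - lattice_sum (S N) N f 0) \<le> K / real N ^ M"
  using F
proof (induction F)
  case empty
  then show ?case by (auto intro!: exI[of _ 0])
next
  case (insert j F)
  then obtain K where K: "K \<ge> 0" "\<And>N y. N \<ge> 1 \<Longrightarrow> y \<in> unit_cube \<Longrightarrow>
     norm (lattice_sum (S N) N f (\<Sum>j\<in>F. (y $ j) *\<^sub>R proj (axis j 1)) - lattice_sum (S N) N f 0) \<le> K / real N ^ M"
    by auto
  obtain L where L: "L \<ge> 0"
    "\<And>S N z s. S \<subseteq> int_lattice \<Longrightarrow> N \<ge> 1 \<Longrightarrow> (\<And>g z. lattice_sum S N g (z + proj (axis j 1)) = lattice_sum S N g z) \<Longrightarrow>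
      norm (lattice_sum S N f (z + s *\<^sub>R proj (axis j 1)) - lattice_sum S N f z) \<le> \<bar>s\<bar> * (L / real N ^ M)"
    using lattice_sum_period_translate_small[OF f, where w="proj (axis j 1)" and M=M] by blast
  have "norm (lattice_sum (S N) N f (\<Sum>j\<in>insert j F. (y $ j) *\<^sub>R proj (axis j 1)) - lattice_sum (S N) N f 0) \<le> (K + L) / real N ^ M"
    if N: "N \<ge> 1" and y: "y \<in> unit_cube" for N y
  proof -
    let ?z = "\<Sum>j\<in>F. (y $ j) *\<^sub>R proj (axis j 1)"
    have "\<bar>y $ j\<bar> * (L / real N ^ M) \<le> 1 * (L / real N ^ M)"
      using y L(1) by (intro mult_right_mono) (auto simp: unit_cube_def less_imp_le)
    then have "norm (lattice_sum (S N) N f (?z + (y $ j) *\<^sub>R proj (axis j 1)) - lattice_sum (S N) N f ?z) \<le> L / real N ^ M"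
      using L(2)[OF S_sub N S_periodic[OF N int_lattice_axis], of ?z "y $ j"] by simp
    from norm_triangle_mono[OF this K(2)[OF N y]] insert.hyps show ?thesis
      by (simp add: add_divide_distrib algebra_simps)
  qed
  then show ?case using K(1) L(1) by (intro exI[of _ "K + L"]) auto
qed

text \<open>Linearity writes \<open>bpt m y = proj y\<close> as the sum in
  \<open>lattice_sum_proj_small\<close>, so the integrand is uniformly close to its value at 0, and
  the cube has measure 1.\<close>

lemma cell_avg_m:
  assumes f: "f \<in> C0_infinity"
  obtains K where "K \<ge> 0" "\<And>N. N \<ge> 1 \<Longrightarrow> norm (lattice_sum (S N) N f 0 - cell_avg m N f) \<le> K / real N ^ M"
proof -
  obtain K where K: "K \<ge> 0" "\<And>N y. N \<ge> 1 \<Longrightarrow> y \<in> unit_cube \<Longrightarrow>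
     norm (lattice_sum (S N) N f (\<Sum>j\<in>UNIV. (y $ j) *\<^sub>R proj (axis j 1)) - lattice_sum (S N) N f 0) \<le> K / real N ^ M"
    using lattice_sum_proj_small[OF f finite[of UNIV], where M=M] by blast
  have proj_eq: "(\<Sum>j\<in>UNIV. (y $ j) *\<^sub>R proj (axis j 1)) = bpt m y" for y
  proof -
    have "y = (\<Sum>j\<in>UNIV. (y $ j) *\<^sub>R axis j 1)"
      using basis_expansion[of y] by (simp add: scalar_mult_eq_scaleR)
    then have "proj y = proj (\<Sum>j\<in>UNIV. (y $ j) *\<^sub>R axis j 1)" by simp
    then show ?thesis by (simp add: bpt_m linear_sum[OF linear_proj] linear_cmul[OF linear_proj])
  qed
  show ?thesis
  proof (rule that[OF K(1)])
    fix N :: nat assume N: "N \<ge> 1"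
    have [measurable]: "(\<lambda>y. lattice_sum (S N) N f (bpt m y)) \<in> borel_measurable borel"
      by (rule lattice_sum_bpt_borel[OF f N])
    obtain C where C: "\<And>z. norm (lattice_sum (S N) N f z) \<le> C"
      using lattice_sum_bounded[OF f] S_sub N by metis
    have i1: "set_integrable lborel unit_cube (\<lambda>y. lattice_sum (S N) N f (bpt m y))"
      by (rule set_integrable_unit_cube[OF _ C]) simp
    have i2: "set_integrable lborel unit_cube (\<lambda>y :: real ^ 'n. lattice_sum (S N) N f 0)"
      by (rule set_integrable_unit_cube[OF _ C]) simp
    have "(LINT y:unit_cube|lborel. lattice_sum (S N) N f (bpt m y) - lattice_sum (S N) N f 0)
        = cell_avg m N f - (LINT y:(unit_cube :: (real ^ 'n) set)|lborel. lattice_sum (S N) N f 0)"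
      unfolding cell_avg_def by (rule set_integral_diff(2)[OF i1 i2])
    also have "(LINT y:(unit_cube :: (real ^ 'n) set)|lborel. lattice_sum (S N) N f 0) = lattice_sum (S N) N f 0"
      unfolding set_lebesgue_integral_def using measure_unit_cube[where 'n='n] finite_emeasure_unit_cube[where 'n='n]
      by (subst integral_scaleR_left) auto
    finally have "cell_avg m N f - lattice_sum (S N) N f 0 = (LINT y:unit_cube|lborel. lattice_sum (S N) N f (bpt m y) - lattice_sum (S N) N f 0)"
      by simp
    also have "norm \<dots> \<le> K / real N ^ M"
      by (rule norm_unit_cube_integral) (use K N in \<open>auto simp: proj_eq\<close>)
    finally show "norm (lattice_sum (S N) N f 0 - cell_avg m N f) \<le> K / real N ^ M"
      by (simp add: norm_minus_commute)
  qed
qed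

end

section \<open>Derivatives of the shifted integral\<close>

lemma norm_set_integral_le:
  fixes g :: "'a::euclidean_space \<Rightarrow> complex"
  assumes bd: "\<And>x. norm (g x) \<le> B" and supp: "\<And>x. g x \<noteq> 0 \<Longrightarrow> norm x \<le> R"
  shows "norm (LINT x:A|lborel. g x) \<le> B * measure lborel (cball 0 R :: 'a set)"
proof -
  have B: "B \<ge> 0" using order_trans[OF norm_ge_zero bd] .
  have fin: "emeasure lborel (cball 0 R :: 'a set) < \<infinity>" by (rule emeasure_bounded_finite) simp
  have ic: "integrable lborel (\<lambda>y. indicat_real (cball 0 R :: 'a set) y * B)"
    using integrableI_bounded_set_indicator[of "cball 0 R :: 'a set" lborel "\<lambda>_. B" B] fin B by simp
  have "norm (LINT x:A|lborel. g x) \<le> (LINT x|lborel. norm (indicat_real A x *\<^sub>R g x))"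
    unfolding set_lebesgue_integral_def by (rule integral_norm_bound)
  also have "\<dots> \<le> (LINT x|lborel. indicat_real (cball 0 R :: 'a set) x * B)"
  proof (rule integral_mono_AE'[OF ic])
    show "AE x in lborel. norm (indicat_real A x *\<^sub>R g x) \<le> indicat_real (cball 0 R) x * B"
    proof (rule AE_I2)
      fix x :: 'a
      show "norm (indicat_real A x *\<^sub>R g x) \<le> indicat_real (cball 0 R) x * B"
        using bd[of x] supp[of x] B by (cases "g x = 0") (auto simp: indicator_def)
    qed
  qed (use B in auto)
  also have "\<dots> = B * measure lborel (cball 0 R :: 'a set)" by simp
  finally show ?thesis .
qed

lemma set_integrable_bounded_support:
  fixes f :: "'a::euclidean_space \<Rightarrow> complex"
  assumes [measurable]: "A \<in> sets borel" "f \<in> borel_measurable borel"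
    and bd: "\<And>x. norm (f x) \<le> B" and supp: "\<And>x. f x \<noteq> 0 \<Longrightarrow> norm x \<le> r"
  shows "set_integrable lborel A f"
proof -
  have B: "B \<ge> 0" using order_trans[OF norm_ge_zero bd] .
  show ?thesis
    unfolding set_integrable_def
    by (rule integrable_bounded_support[where B=B and r=r])
       (use bd supp B in \<open>auto simp: indicator_def\<close>)
qed

text \<open>\<open>taylor_norm_bound\<close> of order 2 on the segment from \<open>x\<close> to
  \<open>x + t *\<^sub>R w\<close>; reparametrising it by \<open>[0, 1]\<close> brings a factor
  \<open>t\<close> per derivative.\<close>

lemma C0_infinity_taylor2:
  fixes f :: "'a::euclidean_space \<Rightarrow> complex"
  assumes f: "f \<in> C0_infinity" and B: "\<And>x. norm ((dderiv w ^^ 2) f x) \<le> B"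
  shows "norm (f (x + t *\<^sub>R w) - f x - t *\<^sub>R dderiv w f x) \<le> t\<^sup>2 * B"
proof -
  define q where "q a s = t ^ a *\<^sub>R (dderiv w ^^ a) f (x + (s * t) *\<^sub>R w)" for a s
  have "norm (q 0 1 - (\<Sum>b<2. (1 ^ b / fact b) *\<^sub>R q b 0)) \<le> t\<^sup>2 * B"
  proof (rule taylor_norm_bound)
    fix a and s :: real
    have "((\<lambda>s. s * t) has_vector_derivative t) (at s)"
      by (auto intro!: derivative_eq_intros)
    from vector_diff_chain_at[OF this C0_infinity_line[OF C0_infinity_dderiv_pow[OF f, where v=w and a=a], of x w "s * t"]]
    have "((\<lambda>s. (dderiv w ^^ a) f (x + (s * t) *\<^sub>R w)) has_vector_derivative t *\<^sub>R (dderiv w ^^ Suc a) f (x + (s * t) *\<^sub>R w)) (at s)"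
      by (simp add: o_def)
    from has_vector_derivative_at_within[OF bounded_linear.has_vector_derivative[OF bounded_linear_scaleR_right[of "t ^ a"] this]]
    show "(q a has_vector_derivative q (Suc a) s) (at s within {0..1})"
      by (simp add: q_def[abs_def] mult.commute)
    show "norm (q 2 s) \<le> t\<^sup>2 * B"
      unfolding q_def using B by (auto intro: mult_left_mono)
  qed auto
  then show ?thesis by (simp add: q_def numeral_2_eq_2 algebra_simps)
qed

text \<open>The pointwise error is at most \<open>t\<^sup>2 * B\<close> and, for
  \<open>\<bar>t\<bar> \<le> 1\<close>, supported in a fixed ball. Its integral is therefore of
  second order in \<open>t\<close>.\<close>

lemma has_vector_derivative_set_integral_line:
  fixes f :: "'a::euclidean_space \<Rightarrow> complex"
  assumes f: "f \<in> C0_infinity" and A: "A \<in> sets borel"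
  shows "((\<lambda>t. LINT x:A|lborel. f (x + t *\<^sub>R w)) has_vector_derivative (LINT x:A|lborel. dderiv w f x)) (at 0)"
proof -
  obtain r where r: "r > 0" "\<And>x. f x \<noteq> 0 \<Longrightarrow> norm x \<le> r" "\<And>x. dderiv w f x \<noteq> 0 \<Longrightarrow> norm x \<le> r"
    using C0_infinity_support[OF f] by metis
  obtain B0 where B0: "\<And>x. norm (f x) \<le> B0" using C0_infinity_bounded[OF f] by metis
  obtain B1 where B1: "\<And>x. norm (dderiv w f x) \<le> B1" using C0_infinity_bounded[OF C0_infinity_dderiv[OF f]] by metis
  obtain B where B: "\<And>x. norm ((dderiv w ^^ 2) f x) \<le> B" using C0_infinity_bounded[OF C0_infinity_dderiv_pow[OF f]] by metis
  have [measurable]: "f \<in> borel_measurable borel" "dderiv w f \<in> borel_measurable borel"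
    using f by (auto intro: C0_infinity_borel C0_infinity_dderiv)
  \<comment> \<open>Contains the supports of all translates of \<open>f\<close> by
    \<open>t *\<^sub>R w\<close> with \<open>\<bar>t\<bar> \<le> 1\<close>.\<close>
  define R where "R = r + norm w"
  define C where "C = B * measure lborel (cball 0 R :: 'a set)"
  define I where "I t = (LINT x:A|lborel. f (x + t *\<^sub>R w))" for t
  have supp: "norm x \<le> R" if "f (x + t *\<^sub>R w) \<noteq> 0" "\<bar>t\<bar> \<le> 1" for x t
  proof -
    have "norm x \<le> norm (x + t *\<^sub>R w) + norm (t *\<^sub>R w)" using norm_triangle_ineq4[of "x + t *\<^sub>R w" "t *\<^sub>R w"] by simp
    also have "\<dots> \<le> r + norm w"
      using r(2)[OF that(1)] that(2) by (intro add_mono) (auto simp: mult_left_le_one_le)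
    finally show ?thesis by (simp add: R_def)
  qed
  have i0: "set_integrable lborel A (\<lambda>x. f (x + t *\<^sub>R w))" if "\<bar>t\<bar> \<le> 1" for t
    by (rule set_integrable_bounded_support[where B=B0 and r=R]) (use A B0 supp that in auto)
  have i1: "set_integrable lborel A (\<lambda>x. t *\<^sub>R dderiv w f x)" for t
    by (intro set_integrable_scaleR_right impI set_integrable_bounded_support[where B=B1 and r=r]) (use A B1 r in auto)
  have main: "norm (I t - I 0 - t *\<^sub>R (LINT x:A|lborel. dderiv w f x)) \<le> t\<^sup>2 * C" if t: "\<bar>t\<bar> \<le> 1" for t
  proof -
    have "I t - I 0 - t *\<^sub>R (LINT x:A|lborel. dderiv w f x) = (LINT x:A|lborel. f (x + t *\<^sub>R w) - f x - t *\<^sub>R dderiv w f x)"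
      using i0[OF t] i0[of 0] i1[of t] unfolding I_def
      by (simp add: set_integral_diff)
    also have "norm \<dots> \<le> t\<^sup>2 * B * measure lborel (cball 0 R :: 'a set)"
    proof (rule norm_set_integral_le)
      show "norm (f (x + t *\<^sub>R w) - f x - t *\<^sub>R dderiv w f x) \<le> t\<^sup>2 * B" for x
        by (rule C0_infinity_taylor2[OF f B])
      fix x assume "f (x + t *\<^sub>R w) - f x - t *\<^sub>R dderiv w f x \<noteq> 0"
      then consider "f (x + t *\<^sub>R w) \<noteq> 0" | "f x \<noteq> 0" | "dderiv w f x \<noteq> 0" by fastforce
      then show "norm x \<le> R"
        using supp[OF _ t] r(2)[of x] r(3)[of x] norm_ge_zero[of w]
        by cases (auto simp: R_def intro: add_increasing2)
    qed
    finally show ?thesis by (simp add: C_def mult.assoc)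
  qed
  have "(I has_derivative (\<lambda>t. t *\<^sub>R (LINT x:A|lborel. dderiv w f x))) (at 0)"
  proof (rule has_derivativeI_sandwich[where e=1 and H="\<lambda>t. \<bar>t\<bar> * C"])
    show "bounded_linear (\<lambda>t::real. t *\<^sub>R (LINT x:A|lborel. dderiv w f x))"
      by (rule bounded_linear_scaleR_left)
    show "norm (I t - I 0 - (t - 0) *\<^sub>R (LINT x:A|lborel. dderiv w f x)) / norm (t - 0) \<le> \<bar>t\<bar> * C"
      if "t \<noteq> 0" "dist t 0 < 1" for t
      using main[of t] that by (simp add: divide_le_eq power2_eq_square mult_ac flip: abs_mult)
    show "((\<lambda>t. \<bar>t\<bar> * C) \<longlongrightarrow> 0) (at 0)"
      by (auto intro!: tendsto_eq_intros)
  qed auto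
  then show ?thesis by (simp add: has_vector_derivative_def I_def[abs_def])
qed

context dual_system
begin

definition shift_integral :: "(real ^ 'n \<Rightarrow> complex) \<Rightarrow> (nat \<Rightarrow> real) \<Rightarrow> complex" where
  "shift_integral f h = (LINT x:halfspaces_Int m u (\<lambda>i. of_int (c i) + h i)|lborel. f x)"

lemma shift_integral_0: "shift_integral f (\<lambda>_. 0) = (LINT x:W|lborel. f x)"
  by (simp add: shift_integral_def W_def)

text \<open>By duality a translation along \<open>v i\<close> moves only the \<open>i\<close>-th
  halfspace. Varying \<open>h i\<close> thus amounts to translating the integrand over a fixed
  domain.\<close>

lemma shift_integral_upd:
  assumes f: "f \<in> C0_infinity" and i: "i < m"
  shows "shift_integral f (h(i := t)) =
    (LINT x:halfspaces_Int m u (\<lambda>i. of_int (c i) + h i)|lborel. f (x + (t - h i) *\<^sub>R v i))"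
proof -
  let ?A = "halfspaces_Int m u (\<lambda>i. of_int (c i) + h i)"
  let ?B = "halfspaces_Int m u (\<lambda>j. of_int (c j) + (h(i := t)) j)"
  have [measurable]: "?A \<in> sets borel" "?B \<in> sets borel" by (simp_all only: borel_closed closed_halfspaces_Int)
  have [measurable]: "f \<in> borel_measurable borel" using f by (rule C0_infinity_borel)
  have "(t - h i) *\<^sub>R v i + x \<in> ?B \<longleftrightarrow> x \<in> ?A" for x
  proof -
    have "u j \<bullet> ((t - h i) *\<^sub>R v i + x) \<le> of_int (c j) + (h(i := t)) j \<longleftrightarrow> u j \<bullet> x \<le> of_int (c j) + h j" if "j < m" for j
      using i that by (auto simp: inner_add_right dual)
    then show ?thesis by (simp add: halfspaces_Int_def)
  qed
  then have "indicat_real ?B ((t - h i) *\<^sub>R v i + x) = indicat_real ?A x" for x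
    by (simp add: indicator_def)
  moreover have "(\<lambda>x. indicat_real ?B x *\<^sub>R f x) \<in> borel_measurable borel" by measurable
  note lborel_integral_translate[OF this, of "(t - h i) *\<^sub>R v i"]
  ultimately show ?thesis
    unfolding shift_integral_def set_lebesgue_integral_def by (simp only: add.commute)
qed

text \<open>With the domain fixed by \<open>shift_integral_upd\<close>, the derivative falls on
  \<open>f\<close> alone. The result has the same form, so the rule iterates.\<close>

lemma partial_deriv_shift_integral:
  assumes f: "f \<in> C0_infinity" and i: "i < m"
  shows "partial_deriv i (shift_integral f) = shift_integral (dderiv (v i) f)"
proof
  fix h :: "nat \<Rightarrow> real"
  let ?A = "halfspaces_Int m u (\<lambda>i. of_int (c i) + h i)"
  have "((\<lambda>t. t - h i) has_vector_derivative 1) (at (h i))"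
    by (auto intro!: derivative_eq_intros)
  moreover have "((\<lambda>t. LINT x:?A|lborel. f (x + t *\<^sub>R v i)) has_vector_derivative (LINT x:?A|lborel. dderiv (v i) f x)) (at (h i - h i))"
    using has_vector_derivative_set_integral_line[OF f borel_closed[OF closed_halfspaces_Int]] by simp
  ultimately have "((\<lambda>t. LINT x:?A|lborel. f (x + t *\<^sub>R v i)) \<circ> (\<lambda>t. t - h i) has_vector_derivative
      1 *\<^sub>R (LINT x:?A|lborel. dderiv (v i) f x)) (at (h i))"
    by (rule vector_diff_chain_at)
  then have "((\<lambda>t. shift_integral f (h(i := t))) has_vector_derivative shift_integral (dderiv (v i) f) h) (at (h i))"
    by (simp add: o_def shift_integral_upd[OF f i] shift_integral_def[of "dderiv (v i) f"])
  then show "partial_deriv i (shift_integral f) h = shift_integral (dderiv (v i) f) h"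
    unfolding partial_deriv_def by (rule vector_derivative_at)
qed

lemma partial_deriv_pow_shift_integral:
  assumes f: "f \<in> C0_infinity" and i: "i < m"
  shows "(partial_deriv i ^^ a) (shift_integral f) = shift_integral ((dderiv (v i) ^^ a) f)"
  by (induction a) (simp_all add: partial_deriv_shift_integral[OF C0_infinity_dderiv_pow[OF f] i])

text \<open>The counterpart of \<open>mixed_partial\<close> on \<open>f\<close>, nested in the same
  order. The parameter \<open>j\<close> limits it to the first \<open>j\<close> directions, for
  induction.\<close>

definition mixed_dderiv :: "nat \<Rightarrow> (nat \<Rightarrow> nat) \<Rightarrow> (real ^ 'n \<Rightarrow> complex) \<Rightarrow> real ^ 'n \<Rightarrow> complex" where
  "mixed_dderiv j \<alpha> = foldr (\<lambda>i. dderiv (v i) ^^ \<alpha> i) [0..<j]"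

lemma mixed_partial_shift_integral:
  assumes f: "f \<in> C0_infinity"
  shows "mixed_partial m \<alpha> (shift_integral f) = shift_integral (mixed_dderiv m \<alpha> f)"
proof -
  have "foldr (\<lambda>i. dderiv (v i) ^^ \<alpha> i) xs f \<in> C0_infinity \<and>
      foldr (\<lambda>i. partial_deriv i ^^ \<alpha> i) xs (shift_integral f) = shift_integral (foldr (\<lambda>i. dderiv (v i) ^^ \<alpha> i) xs f)"
    if "set xs \<subseteq> {..<m}" for xs
    using that by (induction xs) (auto simp: f C0_infinity_dderiv_pow partial_deriv_pow_shift_integral)
  from this[of "[0..<m]"] show ?thesis by (simp add: mixed_partial_def mixed_dderiv_def atLeast0LessThan)
qed

section \<open>The truncated Todd series and the expansion of the cell averages\<close>

lemma finite_multi_indices: "finite {\<alpha> \<in> multi_indices j. multi_degree j \<alpha> < M}"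
proof (rule finite_subset)
  show "{\<alpha> \<in> multi_indices j. multi_degree j \<alpha> < M} \<subseteq> {\<alpha>. \<forall>i. (i \<in> {..<j} \<longrightarrow> \<alpha> i \<in> {..M}) \<and> (i \<notin> {..<j} \<longrightarrow> \<alpha> i = 0)}"
  proof clarsimp
    fix \<alpha> i
    assume \<alpha>: "\<alpha> \<in> multi_indices j" "multi_degree j \<alpha> < M"
    have "\<alpha> i \<le> multi_degree j \<alpha>" if "i < j"
      unfolding multi_degree_def using that by (intro member_le_sum) auto
    then show "(i < j \<longrightarrow> \<alpha> i \<le> M) \<and> (\<not> i < j \<longrightarrow> \<alpha> i = 0)"
      using \<alpha> by (auto simp: multi_indices_def)
  qed
qed (rule finite_set_of_finite_funs, auto)

text \<open>For \<open>j = m\<close> this is \<open>diff_op_trunc\<close> applied to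
  \<open>shift_integral f\<close>; smaller \<open>j\<close> are the intermediate stages that match
  \<open>cell_avg j\<close>.\<close>

definition todd_trunc :: "nat \<Rightarrow> nat \<Rightarrow> (real ^ 'n \<Rightarrow> complex) \<Rightarrow> nat \<Rightarrow> complex" where
  "todd_trunc j N f M = (\<Sum>\<alpha> | \<alpha> \<in> multi_indices j \<and> multi_degree j \<alpha> < M.
     ((\<Prod>i<j. todd_coeff (\<alpha> i)) * (1 / real N) ^ multi_degree j \<alpha>) *\<^sub>R (LINT x:W|lborel. mixed_dderiv j \<alpha> f x))"

text \<open>Split off the exponent \<open>a\<close> of the last direction, which leaves total degree
  below \<open>M - a\<close> for the others. In \<open>mixed_dderiv\<close> the last direction is
  innermost, so it acts directly on \<open>f\<close>.\<close>

lemma todd_trunc_Suc: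
  "todd_trunc (Suc j) N f M = (\<Sum>a<M. (todd_coeff a / real N ^ a) *\<^sub>R todd_trunc j N ((dderiv (v j) ^^ a) f) (M - a))"
proof -
  let ?A = "\<lambda>a. {\<beta>. \<beta> \<in> multi_indices j \<and> multi_degree j \<beta> < M - a}"
  have fold_cong: "mixed_dderiv j (\<beta>(j := a)) = mixed_dderiv j \<beta>" for \<beta> a
    unfolding mixed_dderiv_def by (rule ext, rule foldr_cong) auto
  have deg: "multi_degree j (\<beta>(j := a)) = multi_degree j \<beta>" for \<beta> a
    unfolding multi_degree_def by (rule sum.cong) auto
  have prod: "(\<Prod>i<j. todd_coeff ((\<beta>(j := a)) i)) = (\<Prod>i<j. todd_coeff (\<beta> i))" for \<beta> a
    by (rule prod.cong) auto
  have "(\<Sum>a<M. (todd_coeff a / real N ^ a) *\<^sub>R todd_trunc j N ((dderiv (v j) ^^ a) f) (M - a)) =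
     (\<Sum>(a, \<beta>)\<in>Sigma {..<M} ?A. (todd_coeff a / real N ^ a) *\<^sub>R
        (((\<Prod>i<j. todd_coeff (\<beta> i)) * (1 / real N) ^ multi_degree j \<beta>) *\<^sub>R
         (LINT x:W|lborel. mixed_dderiv j \<beta> ((dderiv (v j) ^^ a) f) x)))"
    unfolding todd_trunc_def scaleR_sum_right
    by (rule sum.Sigma) (auto intro: finite_multi_indices[unfolded Collect_conj_eq] simp: finite_multi_indices)
  also have "\<dots> = todd_trunc (Suc j) N f M"
    unfolding todd_trunc_def
  \<comment> \<open>A multi-index corresponds to its last entry together with the index in which
    that entry is reset to 0.\<close>
  proof (rule sum.reindex_bij_witness[of _ "\<lambda>\<alpha>. (\<alpha> j, \<alpha>(j := 0))" "\<lambda>(a, \<beta>). \<beta>(j := a)"])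
    fix \<alpha> assume \<alpha>: "\<alpha> \<in> {\<alpha>. \<alpha> \<in> multi_indices (Suc j) \<and> multi_degree (Suc j) \<alpha> < M}"
    then have "\<alpha>(j := 0) \<in> multi_indices j"
      by (simp add: multi_indices_def)
    with \<alpha> show "(\<alpha> j, \<alpha>(j := 0)) \<in> Sigma {..<M} ?A"
      by (simp add: deg) (simp add: multi_degree_def less_diff_conv)
  next
    fix p assume "p \<in> Sigma {..<M} ?A"
    then obtain a \<beta> where p: "p = (a, \<beta>)" "a < M" "\<beta> \<in> multi_indices j" "multi_degree j \<beta> < M - a" by auto
    have "multi_degree (Suc j) (\<beta>(j := a)) = multi_degree j \<beta> + a"
      using deg[of \<beta> a] by (simp add: multi_degree_def)
    moreover have "\<beta>(j := a) \<in> multi_indices (Suc j)" using p by (auto simp: multi_indices_def)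
    ultimately show "(case p of (a, \<beta>) \<Rightarrow> \<beta>(j := a)) \<in> {\<alpha>. \<alpha> \<in> multi_indices (Suc j) \<and> multi_degree (Suc j) \<alpha> < M}"
      using p by simp
    show "((\<lambda>(a, \<beta>). \<beta>(j := a)) p j, ((\<lambda>(a, \<beta>). \<beta>(j := a)) p)(j := 0)) = p"
      using p by (auto simp: multi_indices_def fun_eq_iff)
    have "mixed_dderiv (Suc j) (\<beta>(j := a)) f = mixed_dderiv j \<beta> ((dderiv (v j) ^^ a) f)"
      using fold_cong[of \<beta> a] by (simp add: mixed_dderiv_def)
    then show "((\<Prod>i<Suc j. todd_coeff ((case p of (a, \<beta>) \<Rightarrow> \<beta>(j := a)) i)) *
           (1 / real N) ^ multi_degree (Suc j) (case p of (a, \<beta>) \<Rightarrow> \<beta>(j := a))) *\<^sub>R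
          (LINT x:W|lborel. mixed_dderiv (Suc j) (case p of (a, \<beta>) \<Rightarrow> \<beta>(j := a)) f x) =
         (case p of (a, \<beta>) \<Rightarrow> (todd_coeff a / real N ^ a) *\<^sub>R
        (((\<Prod>i<j. todd_coeff (\<beta> i)) * (1 / real N) ^ multi_degree j \<beta>) *\<^sub>R
         (LINT x:W|lborel. mixed_dderiv j \<beta> ((dderiv (v j) ^^ a) f) x)))"
      using \<open>multi_degree (Suc j) (\<beta>(j := a)) = multi_degree j \<beta> + a\<close> prod[of \<beta> a]
      by (simp add: p(1) power_add power_one_over mult_ac divide_inverse power_inverse)
  qed auto
  finally show ?thesis by simp
qed

text \<open>Induction on \<open>j\<close> by \<open>cell_avg_step\<close> and
  \<open>todd_trunc_Suc\<close>, for all \<open>f\<close> and \<open>M\<close> at once: the term of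
  order \<open>a\<close> involves another test function and already carries
  \<open>1 / N ^ a\<close>, so its expansion is needed only to order \<open>M - a\<close>.\<close>

lemma cell_avg_expansion:
  assumes "f \<in> C0_infinity" and "j \<le> m"
  shows "\<exists>K\<ge>0. \<forall>N\<ge>1. norm (cell_avg j N f - todd_trunc j N f M) \<le> K / real N ^ M"
  using assms
proof (induction j arbitrary: f M)
  case 0
  show ?case
  proof (cases "M = 0")
    \<comment> \<open>The truncation is empty, so boundedness is enough. For positive
      \<open>M\<close> only the zero index occurs and \<open>cell_avg_0\<close> is exact.\<close>
    case True
    then show ?thesis
      using cell_avg_bounded[OF 0(1), of 0] by (simp add: todd_trunc_def) metis
  next
    case False
    have "{\<alpha>. \<alpha> \<in> multi_indices 0 \<and> multi_degree 0 \<alpha> < M} = {\<lambda>_. 0}"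
      using False by (auto simp: multi_indices_def multi_degree_def)
    then show ?thesis
      using 0 by (intro exI[of _ 0]) (simp add: todd_trunc_def cell_avg_0 multi_degree_def mixed_dderiv_def)
  qed
next
  case (Suc j)
  then have j: "j < m" and f: "f \<in> C0_infinity" by auto
  obtain K0 where K0: "K0 \<ge> 0" "\<And>N. N \<ge> 1 \<Longrightarrow>
    norm (cell_avg (Suc j) N f - (\<Sum>a<M. (todd_coeff a / real N ^ a) *\<^sub>R cell_avg j N ((dderiv (v j) ^^ a) f))) \<le> K0 / real N ^ M"
    using that by (rule cell_avg_step[OF f j])
  have "\<exists>K\<ge>0. \<forall>N\<ge>1. norm (cell_avg j N ((dderiv (v j) ^^ a) f) - todd_trunc j N ((dderiv (v j) ^^ a) f) (M - a)) \<le> K / real N ^ (M - a)" for a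
    using Suc.IH[OF C0_infinity_dderiv_pow[OF f]] j by simp
  then obtain K where K: "\<And>a. K a \<ge> 0" "\<And>a N. N \<ge> 1 \<Longrightarrow>
      norm (cell_avg j N ((dderiv (v j) ^^ a) f) - todd_trunc j N ((dderiv (v j) ^^ a) f) (M - a)) \<le> K a / real N ^ (M - a)"
    by metis
  show ?case
  proof (intro exI[of _ "K0 + (\<Sum>a<M. \<bar>todd_coeff a\<bar> * K a)"] conjI allI impI)
    show "0 \<le> K0 + (\<Sum>a<M. \<bar>todd_coeff a\<bar> * K a)"
      using K0(1) K(1) by (intro add_nonneg_nonneg sum_nonneg mult_nonneg_nonneg) auto
    fix N :: nat assume N: "N \<ge> 1"
    let ?d = "\<lambda>a. cell_avg j N ((dderiv (v j) ^^ a) f) - todd_trunc j N ((dderiv (v j) ^^ a) f) (M - a)"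
    have tail: "norm (\<Sum>a<M. (todd_coeff a / real N ^ a) *\<^sub>R ?d a) \<le> (\<Sum>a<M. \<bar>todd_coeff a\<bar> * K a / real N ^ M)"
    proof (rule sum_norm_le)
      fix a assume a: "a \<in> {..<M}"
      have "norm ((todd_coeff a / real N ^ a) *\<^sub>R ?d a) \<le> (\<bar>todd_coeff a\<bar> / real N ^ a) * (K a / real N ^ (M - a))"
        unfolding norm_scaleR using K(2)[OF N, of a] by (intro mult_mono) auto
      also have "\<dots> = \<bar>todd_coeff a\<bar> * K a / (real N ^ a * real N ^ (M - a))" by simp
      also have "real N ^ a * real N ^ (M - a) = real N ^ M"
        using a by (simp flip: power_add)
      finally show "norm ((todd_coeff a / real N ^ a) *\<^sub>R ?d a) \<le> \<bar>todd_coeff a\<bar> * K a / real N ^ M" .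
    qed
    have split: "cell_avg (Suc j) N f - todd_trunc (Suc j) N f M =
       (cell_avg (Suc j) N f - (\<Sum>a<M. (todd_coeff a / real N ^ a) *\<^sub>R cell_avg j N ((dderiv (v j) ^^ a) f)))
       + (\<Sum>a<M. (todd_coeff a / real N ^ a) *\<^sub>R ?d a)"
      by (simp add: todd_trunc_Suc scaleR_diff_right sum_subtractf)
    show "norm (cell_avg (Suc j) N f - todd_trunc (Suc j) N f M) \<le> (K0 + (\<Sum>a<M. \<bar>todd_coeff a\<bar> * K a)) / real N ^ M"
      unfolding split using norm_triangle_mono[OF K0(2)[OF N] tail] by (simp add: add_divide_distrib sum_divide_distrib)
  qed
qed

lemma lattice_sum_expansion:
  assumes f: "f \<in> C0_infinity"
  shows "\<exists>K\<ge>0. \<forall>N\<ge>1. norm (lattice_sum (S N) N f 0 -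
      diff_op_trunc m (todd_multi m) (1 / real N) (shift_integral f) M) \<le> K / real N ^ M"
proof -
  have eq: "diff_op_trunc m (todd_multi m) (1 / real N) (shift_integral f) M = todd_trunc m N f M" for N
    by (simp add: diff_op_trunc_def todd_trunc_def taylor_coeff_todd_multi mixed_partial_shift_integral[OF f] shift_integral_0)
  obtain K1 where K1: "K1 \<ge> 0" "\<And>N. N \<ge> 1 \<Longrightarrow> norm (cell_avg m N f - todd_trunc m N f M) \<le> K1 / real N ^ M"
    using cell_avg_expansion[OF f, of m M] by auto
  obtain K2 where K2: "K2 \<ge> 0" "\<And>N. N \<ge> 1 \<Longrightarrow> norm (lattice_sum (S N) N f 0 - cell_avg m N f) \<le> K2 / real N ^ M"
    using that by (rule cell_avg_m[OF f])
  show ?thesis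
    unfolding eq
  proof (intro exI[of _ "K2 + K1"] conjI allI impI)
    fix N :: nat assume N: "N \<ge> 1"
    show "norm (lattice_sum (S N) N f 0 - todd_trunc m N f M) \<le> (K2 + K1) / real N ^ M"
      using norm_triangle_mono[OF K2(2)[OF N] K1(2)[OF N]] by (simp add: add_divide_distrib)
  qed (use K1 K2 in auto)
qed

end

theorem theorem3p2:
  fixes u :: "nat \<Rightarrow> real ^ 'n" and c :: "nat \<Rightarrow> int" and m :: nat
    and f :: "real ^ 'n \<Rightarrow> complex"
  assumes lin_indep: "inj_on u {..<m}" "independent (u ` {..<m})"
    and primitive: "\<And>i. i < m \<Longrightarrow> primitive (u i)"
    and regular: "span (u ` {..<m}) \<inter> int_lattice = int_span m u"
    and f: "f \<in> C0_infinity"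
  defines "W \<equiv> halfspaces_Int m u (\<lambda>i. of_int (c i))"
    and "W_shift \<equiv> (\<lambda>h. halfspaces_Int m u (\<lambda>i. of_int (c i) + h i))"
  shows "\<forall>M\<ge>1.
    (\<lambda>N::nat. 1 / of_nat N ^ CARD('n) *
          (\<Sum>\<^sub>\<infinity>k \<in> int_lattice \<inter> (\<lambda>x. real N *\<^sub>R x) ` W. f (k /\<^sub>R real N))
        - diff_op_trunc m (todd_multi m) (1 / real N) (\<lambda>h. LINT x:W_shift h|lborel. f x) M)
      \<in> O(\<lambda>N. 1 / of_nat N ^ M)"
proof (intro allI impI)
  fix M :: nat
  \<comment> \<open>The arithmetic hypotheses are converted into the dual system here; the rest is
    analytic.\<close>
  obtain v where v: "\<forall>j<m. v j \<in> int_lattice" "\<forall>i<m. \<forall>j<m. u i \<bullet> v j = (if i = j then 1 else 0)"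
    using dual_lattice_vectors[OF lin_indep regular] by blast
  interpret D: dual_system u v c m
    by unfold_locales (use v primitive in \<open>auto simp: primitive_def\<close>)
  obtain K where K: "\<And>N. N \<ge> 1 \<Longrightarrow> norm (lattice_sum (D.S N) N f 0 -
      diff_op_trunc m (todd_multi m) (1 / real N) (D.shift_integral f) M) \<le> K / real N ^ M"
    using D.lattice_sum_expansion[OF f] by blast
  have sum_eq: "1 / of_nat N ^ CARD('n) * (\<Sum>\<^sub>\<infinity>k \<in> int_lattice \<inter> (\<lambda>x. real N *\<^sub>R x) ` W. f (k /\<^sub>R real N))
      = lattice_sum (D.S N) N f 0" for N
    by (simp add: lattice_sum_def D.S_def D.W_def W_def)
  have int_eq: "(\<lambda>h. LINT x:W_shift h|lborel. f x) = D.shift_integral f"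
    by (simp add: fun_eq_iff D.shift_integral_def W_shift_def)
  show "(\<lambda>N::nat. 1 / of_nat N ^ CARD('n) *
          (\<Sum>\<^sub>\<infinity>k \<in> int_lattice \<inter> (\<lambda>x. real N *\<^sub>R x) ` W. f (k /\<^sub>R real N))
        - diff_op_trunc m (todd_multi m) (1 / real N) (\<lambda>h. LINT x:W_shift h|lborel. f x) M)
      \<in> O(\<lambda>N. 1 / of_nat N ^ M)"
    unfolding sum_eq int_eq
  \<comment> \<open>The estimate holds from \<open>N = 1\<close> on; at \<open>N = 0\<close> the
    divisions have only default values, and the asymptotic statement ignores that case.\<close>
  proof (rule bigoI[where c=K])
    show "\<forall>\<^sub>F N in sequentially. norm (lattice_sum (D.S N) N f 0 -
        diff_op_trunc m (todd_multi m) (1 / real N) (D.shift_integral f) M) \<le> K * norm (1 / of_nat N ^ M :: complex)"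
      using eventually_ge_at_top[of 1] by eventually_elim (use K in \<open>simp add: norm_divide norm_power\<close>)
  qed
qed

end
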